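(* For any choice of parameters $\alpha,\beta$, the Grassmannian $G_k(n)$ equipped with the Poisson bracket $\mathcal P_{\alpha,\beta}$ is a Poisson homogeneous space for $GL_n$ (acting on the right in the natural way) equipped with the "matching" Poisson–Lie bracket (same $\alpha,\beta$) $$2\{A_{ij},A_{\bar\imath\bar\jmath}\}=(\alpha-\beta)\big(\mathrm{sign}(\bar\imath-i)+\mathrm{sign}(\bar\jmath-j)\big)A_{i\bar\jmath}A_{\bar\imath j}+(\alpha+\beta)\big(\mathrm{sign}(\bar\imath-i)-\mathrm{sign}(\bar\jmath-j)\big)A_{ij}A_{\bar\imath\bar\jmath},$$ $i,j,\bar\imath,\bar\jmath\in\{1,\dots,n\}$, where $A_{ij}$ are the matrix entries.
   Context: **Poisson homogeneous spaces.** A Lie group $\mathcal G$ with a Poisson bracket is a Poisson–Lie group if the multiplication $\mathcal G\times\mathcal G\to\mathcal G$ is Poisson. If $\mathcal H$ is a Lie subgroup, a Poisson structure on $\mathcal H\backslash\mathcal G$ is Poisson homogeneous if the action map $\mathcal H\backslash\mathcal G\times\mathcal G\to\mathcal H\backslash\mathcal G$ is Poisson (products carry the product Poisson structure). $GL_n$ acts on $G_k(n)$ by right multiplication of $k\times n$ matrix representatives: $(X,A)\mapsto XA$. $\mathrm{sign}(0)=0$. **The bracket $\mathcal P_{\alpha,\beta}$.** $G_k(n)$ is the Grassmannian of $k$-dimensional subspaces of $\mathbb R^n$ (row spans of $k\times n$ matrices). For $I=\{i_1<\dots<i_k\}\subset\{1,\dots,n\}$ and $J$ its complement, $G_k^I(n)$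 is the cell where the Plücker coordinate $x_I$ does not vanish, with coordinates $m^I_{pj}$ ($1\le p\le k$, $j\in J$): the $(p,j)$-entry of the unique matrix representative whose columns indexed by $I$ form the identity matrix. $\mathcal P_{\alpha,\beta}$ is the unique Poisson bracket on $G_k(n)$ whose restriction to each cell $G_k^I(n)$ is $$\{m^I_{pj},m^I_{\bar p\bar\jmath}\}=(\alpha-\beta)\,s_=(i_p,j,i_{\bar p},\bar\jmath)\,m^I_{p\bar\jmath}m^I_{\bar pj}+(\alpha+\beta)\,s_\times(i_p,j,i_{\bar p},\bar\jmath)\,m^I_{pj}m^I_{\bar p\bar\jmath}.$$ Here $a\prec b\prec c\prec\cdots$ means that the (distinct) indices occur in this cyclic order modulo $n$, and for $i,i'\in I$, $j,j'\in J$, $$s_=(i,j,i',j')=\begin{cases}1&\text{if } i\prec i'\prec j'\prec j,\\ -1&\text{if } i'\prec i\prec j\prec j',\\ \tfrac12&\text{if } i=i'\prec j'\prec j\text{ or } i\prec i'\prec j'=j,\\ -\tfrac12&\text{if } i'=i\prec j\prec j'\text{ or } i'\prec i\prec j=j',\\ 0&\text{otherwise,}\end{cases}$$ $$s_\times(i,j,i',j')=\begin{cases}1&\text{if } i'\prec i\prec j'\prec j,\\ -1&\text{if } i\prec i'\prec j\prec j',\\ \tfrac12&\text{if } i'=i\prec j'\prec j\text{ or } i'\prec i\prec j'=j,\\ -\tfrac12&\text{if } i=i'\prec j\prec j'\text{ or } i\prec i'\prec j=j',\\ 0&\text{otherwise.}\end{cases}$$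
   Formalization: The displayed bracket on GL_n is not the matching one if α≠β (k=1, n=3: at span(e_1) the action gives −β m_2m_3 where P_{α,β} has −α m_2m_3); the claim is proved with α and β exchanged in the GL_n bracket, i.e. with the sign of its (α−β) term reversed. *)

theory Defs
  imports "HOL-Analysis.Analysis" "HOL-Algebra.Coset"
begin

section \<open>Smooth spaces and Poisson brackets\<close>

fun Ck_on :: "nat \<Rightarrow> 'e::real_normed_vector set \<Rightarrow> ('e \<Rightarrow> real) \<Rightarrow> bool" where
  "Ck_on 0 S f \<longleftrightarrow> continuous_on S f"
| "Ck_on (Suc r) S f \<longleftrightarrow>
     (\<forall>x\<in>S. f differentiable (at x)) \<and>
     (\<forall>v. Ck_on r S (\<lambda>x. frechet_derivative f (at x) v))"

definition smooth_on :: "'e::real_normed_vector set \<Rightarrow> ('e \<Rightarrow> real) \<Rightarrow> bool" where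
  "smooth_on S f \<longleftrightarrow> (\<forall>r. Ck_on r S f)"

text \<open>A smooth manifold is presented by local parametrizations \<open>\<phi> : U \<rightarrow> M\<close> (inverse charts,
  with \<open>U\<close> open in a normed space). A parametrization is allowed to carry redundant
  parameters on which it does not depend: this does not change which functions are smooth.
  Functions on \<open>M\<close> are total functions on the ambient type, and only their values on
  \<open>pts\<close> matter.\<close>

record ('e, 'x) space =
  pts :: "'x set"
  plots :: "('e set \<times> ('e \<Rightarrow> 'x)) set"

definition smooth_fun :: "('e::real_normed_vector, 'x) space \<Rightarrow> ('x \<Rightarrow> real) \<Rightarrow> bool" where
  "smooth_fun X f \<longleftrightarrow> (\<forall>(U, \<phi>) \<in> plots X. smooth_on U (f \<circ> \<phi>))"

definition smooth_map ::
  "('e::real_normed_vector, 'x) space \<Rightarrow> ('d::real_normed_vector, 'y) space \<Rightarrow> ('x \<Rightarrow> 'y) \<Rightarrow> bool"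
  where
  "smooth_map X Y \<Phi> \<longleftrightarrow>
     \<Phi> ` pts X \<subseteq> pts Y \<and> (\<forall>f. smooth_fun Y f \<longrightarrow> smooth_fun X (f \<circ> \<Phi>))"

definition prod_space :: "('e, 'x) space \<Rightarrow> ('d, 'y) space \<Rightarrow> ('e \<times> 'd, 'x \<times> 'y) space" where
  "prod_space X Y =
     \<lparr>pts = pts X \<times> pts Y,
      plots = {(U \<times> V, map_prod \<phi> \<psi>) | U \<phi> V \<psi>. (U, \<phi>) \<in> plots X \<and> (V, \<psi>) \<in> plots Y}\<rparr>"

type_synonym 'x bracket = "('x \<Rightarrow> real) \<Rightarrow> ('x \<Rightarrow> real) \<Rightarrow> 'x \<Rightarrow> real"

text \<open>The first two clauses say that \<open>B\<close> is an operation on smooth functions on \<open>pts X\<close>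
  (closedness, and independence of values outside \<open>pts X\<close>); the remaining ones are
  skew-symmetry, linearity, the Leibniz rule and the Jacobi identity.\<close>

definition poisson_bracket :: "('e::real_normed_vector, 'x) space \<Rightarrow> 'x bracket \<Rightarrow> bool" where
  "poisson_bracket X B \<longleftrightarrow>
     (\<forall>f g. smooth_fun X f \<longrightarrow> smooth_fun X g \<longrightarrow> smooth_fun X (B f g)) \<and>
     (\<forall>f f' g. smooth_fun X f \<longrightarrow> smooth_fun X f' \<longrightarrow> smooth_fun X g \<longrightarrow>
        (\<forall>x\<in>pts X. f x = f' x) \<longrightarrow> (\<forall>x\<in>pts X. B f g x = B f' g x)) \<and>
     (\<forall>f g h c. smooth_fun X f \<longrightarrow> smooth_fun X g \<longrightarrow> smooth_fun X h \<longrightarrow>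
        (\<forall>x\<in>pts X.
           B f g x = - B g f x \<and>
           B (\<lambda>u. f u + g u) h x = B f h x + B g h x \<and>
           B (\<lambda>u. c * f u) h x = c * B f h x \<and>
           B (\<lambda>u. f u * g u) h x = f x * B g h x + B f h x * g x \<and>
           B f (B g h) x + B g (B h f) x + B h (B f g) x = 0))"

text \<open>The product Poisson structure.\<close>

definition prod_bracket :: "'x bracket \<Rightarrow> 'y bracket \<Rightarrow> ('x \<times> 'y) bracket" where
  "prod_bracket B C F G =
     (\<lambda>(x, y). B (\<lambda>u. F (u, y)) (\<lambda>u. G (u, y)) x + C (\<lambda>v. F (x, v)) (\<lambda>v. G (x, v)) y)"

definition poisson_map ::
  "('e::real_normed_vector, 'x) space \<Rightarrow> 'x bracket \<Rightarrow>
   ('d::real_normed_vector, 'y) space \<Rightarrow> 'y bracket \<Rightarrow> ('x \<Rightarrow> 'y) \<Rightarrow> bool" where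
  "poisson_map X B Y C \<Phi> \<longleftrightarrow>
     smooth_map X Y \<Phi> \<and>
     (\<forall>f g. smooth_fun Y f \<longrightarrow> smooth_fun Y g \<longrightarrow>
        (\<forall>x\<in>pts X. B (f \<circ> \<Phi>) (g \<circ> \<Phi>) x = C f g (\<Phi> x)))"

section \<open>Poisson--Lie groups and Poisson homogeneous spaces\<close>

definition lie_group :: "('e::real_normed_vector, 'g) space \<Rightarrow> 'g monoid \<Rightarrow> bool" where
  "lie_group X G \<longleftrightarrow>
     group G \<and> carrier G = pts X \<and>
     smooth_map (prod_space X X) X (\<lambda>(a, b). a \<otimes>\<^bsub>G\<^esub> b) \<and>
     smooth_map X X (\<lambda>a. inv\<^bsub>G\<^esub> a)"

definition poisson_lie_group ::
  "('e::real_normed_vector, 'g) space \<Rightarrow> 'g monoid \<Rightarrow> 'g bracket \<Rightarrow> bool" where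
  "poisson_lie_group X G B \<longleftrightarrow>
     lie_group X G \<and> poisson_bracket X B \<and>
     poisson_map (prod_space X X) (prod_bracket B B) X B (\<lambda>(a, b). a \<otimes>\<^bsub>G\<^esub> b)"

text \<open>\<open>M\<close> with the right \<open>G\<close>-action \<open>act\<close> is a homogeneous space \<open>H\<setminus>G\<close>: for some
  base point \<open>x0\<close> and some Lie (that is, closed) subgroup \<open>H\<close>, the map \<open>H g \<mapsto> x0 g\<close> is a
  well-defined bijection of the set of cosets onto \<open>M\<close>, and the smooth functions on \<open>M\<close> are
  those whose pullback to \<open>G\<close> is smooth (the quotient smooth structure).\<close>

definition homogeneous_space ::
  "('e::real_normed_vector, 'g::topological_space) space \<Rightarrow> 'g monoid \<Rightarrow>
   ('d::real_normed_vector, 'x) space \<Rightarrow> ('x \<Rightarrow> 'g \<Rightarrow> 'x) \<Rightarrow> bool" where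
  "homogeneous_space X G M act \<longleftrightarrow>
     (\<forall>x\<in>pts M. act x \<one>\<^bsub>G\<^esub> = x) \<and>
     (\<forall>x\<in>pts M. \<forall>g\<in>carrier G. \<forall>h\<in>carrier G. act x (g \<otimes>\<^bsub>G\<^esub> h) = act (act x g) h) \<and>
     (\<exists>x0\<in>pts M. \<exists>H. subgroup H G \<and> closedin (top_of_set (carrier G)) H \<and>
        (\<forall>g\<in>carrier G. \<forall>h\<in>carrier G. act x0 g = act x0 h \<longleftrightarrow> H #>\<^bsub>G\<^esub> g = H #>\<^bsub>G\<^esub> h) \<and>
        act x0 ` carrier G = pts M \<and>
        (\<forall>f. smooth_fun M f \<longleftrightarrow> smooth_fun X (\<lambda>g. f (act x0 g))))"

definition poisson_homogeneous_space ::
  "('e::real_normed_vector, 'g::topological_space) space \<Rightarrow> 'g monoid \<Rightarrow> 'g bracket \<Rightarrow>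
   ('d::real_normed_vector, 'x) space \<Rightarrow> ('x \<Rightarrow> 'g \<Rightarrow> 'x) \<Rightarrow> 'x bracket \<Rightarrow> bool" where
  "poisson_homogeneous_space X G B M act P \<longleftrightarrow>
     poisson_lie_group X G B \<and>
     homogeneous_space X G M act \<and>
     poisson_bracket M P \<and>
     poisson_map (prod_space M X) (prod_bracket P B) M P (\<lambda>(x, g). act x g)"

section \<open>Brackets given by the brackets of matrix entries\<close>

text \<open>Partial derivative with respect to the \<open>(p, j)\<close> matrix entry.\<close>

definition pderiv_entry :: "(real^'c^'r \<Rightarrow> real) \<Rightarrow> 'r::finite \<Rightarrow> 'c::finite \<Rightarrow> real^'c^'r \<Rightarrow> real" where
  "pderiv_entry F p j M = frechet_derivative F (at M) (axis p (axis j 1))"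

text \<open>The bracket \<open>{F, G} = \<Sum> (\<partial>F/\<partial>m\<^bsub>pj\<^esub>) (\<partial>G/\<partial>m\<^bsub>qk\<^esub>) {m\<^bsub>pj\<^esub>, m\<^bsub>qk\<^esub>}\<close> of functions of the
  coordinates \<open>m\<^bsub>pj\<^esub>\<close>, \<open>j \<in> J\<close>, determined by the brackets
  \<open>{m\<^bsub>pj\<^esub>, m\<^bsub>qk\<^esub>} = c p j q k\<close> of these coordinates.\<close>

definition entries_bracket ::
  "'c::finite set \<Rightarrow> ('r::finite \<Rightarrow> 'c \<Rightarrow> 'r \<Rightarrow> 'c \<Rightarrow> real^'c^'r \<Rightarrow> real) \<Rightarrow> (real^'c^'r) bracket" where
  "entries_bracket J c F G M =
     (\<Sum>p\<in>UNIV. \<Sum>j\<in>J. \<Sum>q\<in>UNIV. \<Sum>k\<in>J.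
        pderiv_entry F p j M * pderiv_entry G q k M * c p j q k M)"

section \<open>The Grassmannian\<close>

text \<open>The index sets \<open>{1..k}\<close> and \<open>{1..n}\<close> are finite linearly ordered types \<open>'k\<close> and \<open>'n\<close>.
  A \<open>k\<close>-subset \<open>I = {i\<^sub>1 < \<dots> < i\<^sub>k}\<close> is given by the strictly increasing map
  \<open>\<iota> : p \<mapsto> i\<^sub>p\<close>, so that \<open>I = range \<iota>\<close>.\<close>

text \<open>The matrix whose columns in \<open>I\<close> form the identity matrix and whose other entries are those
  of \<open>M\<close>; the entries of \<open>M\<close> in the columns \<open>I\<close> are redundant parameters.\<close>

definition cell_matrix :: "('k::finite \<Rightarrow> 'n::finite) \<Rightarrow> real^'n^'k \<Rightarrow> real^'n^'k" where
  "cell_matrix \<iota> M =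
     (\<chi> p j. if j \<in> range \<iota> then (if j = \<iota> p then 1 else 0) else M $ p $ j)"

text \<open>The point of the cell \<open>I\<close> with coordinates \<open>m\<^sup>I\<^bsub>pj\<^esub> = M $ p $ j\<close>, \<open>j \<notin> I\<close>;
  the range of \<open>cell_param \<iota>\<close> is the cell.\<close>

definition cell_param :: "('k::finite \<Rightarrow> 'n::finite) \<Rightarrow> real^'n^'k \<Rightarrow> (real^'n) set" where
  "cell_param \<iota> M = span (rows (cell_matrix \<iota> M))"

definition grassmannian ::
  "(real^'n::{finite,linorder}^'k::{finite,linorder}, (real^'n::{finite,linorder}) set) space" where
  "grassmannian =
     \<lparr>pts = {V. subspace V \<and> dim V = CARD('k)},
      plots = {(UNIV, cell_param \<iota>) | \<iota> :: 'k \<Rightarrow> 'n. strict_mono \<iota>}\<rparr>"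

text \<open>If \<open>V\<close> is the row span of \<open>X\<close>, then \<open>grassmannian_act V A\<close> is the row span of
  \<open>X ** A\<close>.\<close>

definition grassmannian_act :: "(real^'n::finite) set \<Rightarrow> real^'n^'n \<Rightarrow> (real^'n) set" where
  "grassmannian_act V A = (\<lambda>x. x v* A) ` V"

text \<open>\<open>cyc [a, b, c, \<dots>]\<close> means \<open>a \<prec> b \<prec> c \<prec> \<dots>\<close>: the indices are distinct and occur in
  this cyclic order.\<close>

definition cyc :: "'n::linorder list \<Rightarrow> bool" where
  "cyc xs \<longleftrightarrow> (\<exists>m. sorted_wrt (<) (rotate m xs))"

definition s_par :: "'n::linorder \<Rightarrow> 'n \<Rightarrow> 'n \<Rightarrow> 'n \<Rightarrow> real" where
  "s_par i j i' j' =
     (if cyc [i, i', j', j] then 1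
      else if cyc [i', i, j, j'] then -1
      else if i = i' \<and> cyc [i, j', j] \<or> j' = j \<and> cyc [i, i', j] then 1/2
      else if i' = i \<and> cyc [i, j, j'] \<or> j = j' \<and> cyc [i', i, j] then -1/2
      else 0)"

definition s_cross :: "'n::linorder \<Rightarrow> 'n \<Rightarrow> 'n \<Rightarrow> 'n \<Rightarrow> real" where
  "s_cross i j i' j' =
     (if cyc [i', i, j', j] then 1
      else if cyc [i, i', j, j'] then -1
      else if i' = i \<and> cyc [i, j', j] \<or> j' = j \<and> cyc [i', i, j] then 1/2
      else if i = i' \<and> cyc [i, j, j'] \<or> j = j' \<and> cyc [i, i', j] then -1/2
      else 0)"

definition cell_coeff ::
  "real \<Rightarrow> real \<Rightarrow> ('k::finite \<Rightarrow> 'n::{finite,linorder}) \<Rightarrow>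
   'k \<Rightarrow> 'n \<Rightarrow> 'k \<Rightarrow> 'n \<Rightarrow> real^'n::{finite,linorder}^'k \<Rightarrow> real" where
  "cell_coeff \<alpha> \<beta> \<iota> p j q k M =
     (\<alpha> - \<beta>) * s_par (\<iota> p) j (\<iota> q) k * (M $ p $ k) * (M $ q $ j) +
     (\<alpha> + \<beta>) * s_cross (\<iota> p) j (\<iota> q) k * (M $ p $ j) * (M $ q $ k)"

text \<open>\<open>P\<close> is the Poisson bracket \<open>\<P>\<^bsub>\<alpha>,\<beta>\<^esub>\<close>. Since the cells cover the
  Grassmannian, the second clause determines \<open>P f g\<close> on it for all smooth \<open>f\<close>, \<open>g\<close>.\<close>

definition grassmannian_bracket ::
  "real \<Rightarrow> real \<Rightarrow> 'k::{finite,linorder} itself \<Rightarrow>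
   (real^'n::{finite,linorder}) set bracket \<Rightarrow> bool" where
  "grassmannian_bracket \<alpha> \<beta> _ P \<longleftrightarrow>
     poisson_bracket (grassmannian :: (real^'n::{finite,linorder}^'k::{finite,linorder}, _) space) P \<and>
     (\<forall>(\<iota> :: 'k \<Rightarrow> 'n) f g M. strict_mono \<iota> \<longrightarrow>
        smooth_fun (grassmannian :: (real^'n::{finite,linorder}^'k::{finite,linorder}, _) space) f \<longrightarrow>
        smooth_fun (grassmannian :: (real^'n::{finite,linorder}^'k::{finite,linorder}, _) space) g \<longrightarrow>
        P f g (cell_param \<iota> M) =
          entries_bracket (- range \<iota>) (cell_coeff \<alpha> \<beta> \<iota>) (f \<circ> cell_param \<iota>) (g \<circ> cell_param \<iota>) M)"

section \<open>The general linear group\<close>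

definition GL_space :: "(real^'n^'n, real^'n^'n) space" where
  "GL_space = \<lparr>pts = {A. invertible A}, plots = {({A. invertible A}, \<lambda>A. A)}\<rparr>"

definition GL_group :: "(real^'n^'n) monoid" where
  "GL_group = \<lparr>carrier = {A. invertible A}, mult = (**), one = mat 1\<rparr>"

text \<open>\<open>sign_diff i' i\<close> is \<open>sign (i' - i)\<close>.\<close>

definition sign_diff :: "'n::linorder \<Rightarrow> 'n \<Rightarrow> real" where
  "sign_diff i' i = (if i < i' then 1 else if i' < i then -1 else 0)"

definition GL_coeff ::
  "real \<Rightarrow> real \<Rightarrow> 'n::{finite,linorder} \<Rightarrow> 'n \<Rightarrow> 'n \<Rightarrow> 'n \<Rightarrow>
   real^'n::{finite,linorder}^'n::{finite,linorder} \<Rightarrow> real" where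
  "GL_coeff \<alpha> \<beta> i j i' j' A =
     ((\<alpha> - \<beta>) * (sign_diff i' i + sign_diff j' j) * (A $ i $ j') * (A $ i' $ j) +
      (\<alpha> + \<beta>) * (sign_diff i' i - sign_diff j' j) * (A $ i $ j) * (A $ i' $ j')) / 2"

text \<open>With these sign conventions the bracket on \<open>GL\<^sub>n\<close> that matches \<open>\<P>\<^bsub>\<alpha>,\<beta>\<^esub>\<close> is
  \<open>GL_bracket \<beta> \<alpha>\<close>, not \<open>GL_bracket \<alpha> \<beta>\<close>: for \<open>k = 1\<close>, \<open>n = 3\<close>, the bracket \<open>\<P>\<^bsub>\<alpha>,\<beta>\<^esub>\<close> has
  \<open>{m\<^sub>2, m\<^sub>3} = - \<alpha> m\<^sub>2 m\<^sub>3\<close> in the cell \<open>I = {1}\<close> and vanishes at \<open>span {e\<^sub>1}\<close>, so the action can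
  only be Poisson if \<open>{A\<^sub>1\<^sub>2/A\<^sub>1\<^sub>1, A\<^sub>1\<^sub>3/A\<^sub>1\<^sub>1} = - \<alpha> A\<^sub>1\<^sub>2A\<^sub>1\<^sub>3/A\<^sub>1\<^sub>1\<^sup>2\<close>; under \<open>GL_bracket \<alpha> \<beta>\<close> the
  left-hand side is \<open>- \<beta> A\<^sub>1\<^sub>2A\<^sub>1\<^sub>3/A\<^sub>1\<^sub>1\<^sup>2\<close>.\<close>

definition GL_bracket :: "real \<Rightarrow> real \<Rightarrow> (real^'n::{finite,linorder}^'n::{finite,linorder}) bracket" where
  "GL_bracket \<alpha> \<beta> = entries_bracket UNIV (GL_coeff \<alpha> \<beta>)"

end

theory Submission
  imports Defs
begin

text \<open>
  The quadratic formula that defines the bracket of \<open>GL\<^sub>n\<close> makes sense for rectangular matrices of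
  any size. It defines a Poisson bracket there, and the matrix product
  \<open>M\<^bsub>k\<times>m\<^esub> \<times> M\<^bsub>m\<times>n\<^esub> \<rightarrow> M\<^bsub>k\<times>n\<^esub>\<close> is a Poisson map. Taking \<open>m = k\<close>, the
  functions on \<open>k \<times> n\<close> matrices that are invariant under left multiplication by \<open>GL\<^sub>k\<close> are closed
  under the bracket, so on matrices of full rank it descends to a bracket on the Grassmannian; taking
  \<open>m = n\<close>, the right action of \<open>GL\<^sub>n\<close> is Poisson. In a cell, invariance expresses the derivatives
  along the columns in \<open>I\<close> by the remaining ones, and eliminating them turns the quadratic formula
  into the formula that defines \<open>\<P>\<^bsub>\<alpha>,\<beta>\<^esub>\<close>, because
  \<open>2 s\<^sub>=(i, j, i', j') = sign (i' - i) + sign (j' - i') + sign (j - j') + sign (i - j)\<close> and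
  \<open>s\<^sub>\<times>(i, j, i', j') = s\<^sub>=(i', j, i, j')\<close>.
\<close>

section \<open>Smooth functions\<close>

text \<open>Calculus on the Grassmannian is replaced by calculus on the open set of full-rank
  matrices: a function \<open>f\<close> is studied through its pullback
  \<open>f (row_span X)\<close>, and brackets are compared on representatives. The sign pattern of
  the quadratic formula is what makes products Poisson. In \<open>X ** A\<close> the summed index is
  a column index of \<open>X\<close> and a row index of \<open>A\<close>; in the term with constant
  \<open>a\<close> interchanging the two summation indices reverses its sign, in the term with
  constant \<open>b\<close> row and column signs are opposite from the start, so both contributions
  cancel. The constants come from the restriction to a cell. Eliminating the columns in
  \<open>I\<close> leaves \<open>-2\<close> times the sign for \<open>s_par\<close> in the
  \<open>a\<close> term and \<open>2\<close> times the sign for \<open>s_cross\<close> in the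
  \<open>b\<close> term. This forces \<open>a = (\<beta> - \<alpha>) / 2\<close> and
  \<open>b = (\<alpha> + \<beta>) / 2\<close>, and it is the reason why \<alpha> and \<beta> are
  interchanged in \<open>GL_bracket \<beta> \<alpha>\<close>.\<close>

lemma Ck_on_has_derivative:
  assumes "Ck_on (Suc r) S f" "x \<in> S"
  shows "(f has_derivative frechet_derivative f (at x)) (at x)"
  using assms by (simp add: frechet_derivative_works)

lemma Ck_on_mono: "Ck_on (Suc r) S f \<Longrightarrow> Ck_on r S f"
proof (induction r arbitrary: f)
  case 0
  then show ?case
    by (auto intro!: continuous_at_imp_continuous_on differentiable_imp_continuous_within)
next
  case (Suc r)
  from Suc.prems have "Ck_on (Suc r) S (\<lambda>x. frechet_derivative f (at x) v)" for v
    by simp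
  then have "Ck_on r S (\<lambda>x. frechet_derivative f (at x) v)" for v
    using Suc.IH by blast
  then show ?case
    using Suc.prems by simp
qed

lemma Ck_on_subset: "Ck_on r S f \<Longrightarrow> T \<subseteq> S \<Longrightarrow> Ck_on r T f"
  by (induction r arbitrary: f) (auto intro: continuous_on_subset)

lemma Ck_on_cong:
  assumes "open S" "Ck_on r S f" "\<And>x. x \<in> S \<Longrightarrow> f x = g x"
  shows "Ck_on r S g"
  using assms(2,3)
proof (induction r arbitrary: f g)
  case 0
  then show ?case by (simp cong: continuous_on_cong)
next
  case (Suc r)
  have D: "(g has_derivative frechet_derivative f (at x)) (at x)" if "x \<in> S" for x
    using has_derivative_transform_within_open[OF Ck_on_has_derivative[OF Suc.prems(1) that] assms(1) that]
      Suc.prems(2) by blast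
  then have eq: "frechet_derivative f (at x) = frechet_derivative g (at x)" if "x \<in> S" for x
    using frechet_derivative_at that by blast
  have "Ck_on r S (\<lambda>x. frechet_derivative g (at x) v)" for v
  proof (rule Suc.IH)
    show "Ck_on r S (\<lambda>x. frechet_derivative f (at x) v)"
      using Suc.prems(1) by simp
  qed (simp add: eq)
  moreover have "g differentiable (at x)" if "x \<in> S" for x
    using D[OF that] by (rule differentiableI)
  ultimately show ?case by simp
qed

text \<open>\<open>Ck_on\<close> refers to the chosen \<open>frechet_derivative\<close>. Accepting
  any explicit derivative instead lets the closure rules for constants, linear maps, sums, products,
  inverses and composites run by induction on the order.\<close>

lemma Ck_on_SucI:
  assumes "open S" "\<And>x. x \<in> S \<Longrightarrow> (f has_derivative f' x) (at x)"
    "\<And>v. Ck_on r S (\<lambda>x. f' x v)"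
  shows "Ck_on (Suc r) S f"
proof -
  have "f' x = frechet_derivative f (at x)" if "x \<in> S" for x
    using frechet_derivative_at assms(2) that by blast
  then have "Ck_on r S (\<lambda>x. frechet_derivative f (at x) v)" for v
    by (intro Ck_on_cong[OF assms(1) assms(3)[of v]]) simp
  moreover have "f differentiable (at x)" if "x \<in> S" for x
    using assms(2)[OF that] by (rule differentiableI)
  ultimately show ?thesis by simp
qed

lemma Ck_on_const: "open S \<Longrightarrow> Ck_on r S (\<lambda>x. c)"
proof (induction r arbitrary: c)
  case (Suc r)
  show ?case
    by (rule Ck_on_SucI[where f' = "\<lambda>x v. 0"]) (simp_all add: Suc.prems Suc.IH)
qed simp

lemma Ck_on_bounded_linear: "open S \<Longrightarrow> bounded_linear f \<Longrightarrow> Ck_on r S f"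
proof (induction r)
  case 0
  then show ?case by (simp add: linear_continuous_on)
next
  case (Suc r)
  show ?case
    by (rule Ck_on_SucI[where f' = "\<lambda>x. f"])
      (simp_all add: Suc.prems Ck_on_const bounded_linear_imp_has_derivative)
qed

lemma Ck_on_add:
  "open S \<Longrightarrow> Ck_on r S f \<Longrightarrow> Ck_on r S g \<Longrightarrow> Ck_on r S (\<lambda>x. f x + g x)"
proof (induction r arbitrary: f g)
  case 0
  then show ?case by (simp add: continuous_on_add)
next
  case (Suc r)
  show ?case
  proof (rule Ck_on_SucI)
    show "((\<lambda>x. f x + g x) has_derivative
        (\<lambda>v. frechet_derivative f (at x) v + frechet_derivative g (at x) v)) (at x)" if "x \<in> S" for x
      by (intro has_derivative_add Ck_on_has_derivative[OF _ that]) fact+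
  qed (use Suc in auto)
qed

lemma Ck_on_mult:
  "open S \<Longrightarrow> Ck_on r S f \<Longrightarrow> Ck_on r S g \<Longrightarrow> Ck_on r S (\<lambda>x. f x * g x)"
proof (induction r arbitrary: f g)
  case 0
  then show ?case by (simp add: continuous_on_mult)
next
  case (Suc r)
  show ?case
  proof (rule Ck_on_SucI)
    show "((\<lambda>x. f x * g x) has_derivative
        (\<lambda>v. f x * frechet_derivative g (at x) v + frechet_derivative f (at x) v * g x)) (at x)"
      if "x \<in> S" for x
      by (intro has_derivative_mult Ck_on_has_derivative[OF _ that]) fact+
    \<comment> \<open>The product rule brings back \<open>f\<close> and \<open>g\<close> themselves,
      which are first lowered from order \<open>Suc r\<close> to \<open>r\<close>.\<close>
    show "Ck_on r S (\<lambda>x. f x * frechet_derivative g (at x) v + frechet_derivative f (at x) v * g x)" for v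
      using Suc.prems Ck_on_mono[OF Suc.prems(2)] Ck_on_mono[OF Suc.prems(3)]
      by (intro Ck_on_add Suc.IH) auto
  qed fact
qed

lemma Ck_on_inverse:
  "open S \<Longrightarrow> Ck_on r S f \<Longrightarrow> (\<And>x. x \<in> S \<Longrightarrow> f x \<noteq> 0) \<Longrightarrow> Ck_on r S (\<lambda>x. inverse (f x))"
proof (induction r arbitrary: f)
  case 0
  then show ?case by (simp add: continuous_on_inverse)
next
  case (Suc r)
  show ?case
  proof (rule Ck_on_SucI)
    show "((\<lambda>x. inverse (f x)) has_derivative
        (\<lambda>v. (-1) * (inverse (f x) * frechet_derivative f (at x) v * inverse (f x)))) (at x)"
      if "x \<in> S" for x
      using Deriv.has_derivative_inverse[OF Suc.prems(3)[OF that] Ck_on_has_derivative[OF Suc.prems(2) that]]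
      by simp
    \<comment> \<open>The derivative contains \<open>inverse (f x)\<close> again; the induction
      hypothesis covers it once \<open>f\<close> is lowered by one order.\<close>
    show "Ck_on r S (\<lambda>x. (-1) * (inverse (f x) * frechet_derivative f (at x) v * inverse (f x)))" for v
      using Suc.prems Suc.IH[OF _ Ck_on_mono[OF Suc.prems(2)]]
      by (intro Ck_on_mult Ck_on_const) auto
  qed fact
qed

lemma Ck_on_sum:
  "open S \<Longrightarrow> (\<And>i. i \<in> I \<Longrightarrow> Ck_on r S (f i)) \<Longrightarrow> Ck_on r S (\<lambda>x. \<Sum>i\<in>I. f i x)"
  by (induction I rule: infinite_finite_induct) (auto intro: Ck_on_const Ck_on_add)

text \<open>Differentiability classes exist only for real-valued functions, so \<open>g\<close>
  enters through its coordinates. Expanding in the basis makes the chain rule a finite sum of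
  products, whose factors are derivatives of coordinates of \<open>g\<close> and partial derivatives
  of \<open>f\<close> composed with \<open>g\<close>; the latter fall under the induction
  hypothesis.\<close>

lemma Ck_on_compose:
  fixes g :: "'d::real_normed_vector \<Rightarrow> 'e::euclidean_space"
  assumes "open S" "open T" "g ` S \<subseteq> T"
  shows "Ck_on r T f \<Longrightarrow> (\<And>b. b \<in> Basis \<Longrightarrow> Ck_on r S (\<lambda>x. g x \<bullet> b)) \<Longrightarrow> Ck_on r S (\<lambda>x. f (g x))"
proof (induction r arbitrary: f)
  case 0
  have "continuous_on S g"
    using 0 by (auto intro: continuous_on_componentwise[THEN iffD2])
  then show ?case
    using 0 assms(3) continuous_on_compose2 by auto
next
  case (Suc r)
  define g' where "g' x v = (\<Sum>b\<in>Basis. frechet_derivative (\<lambda>x. g x \<bullet> b) (at x) v *\<^sub>R b)" for x v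
  have "((\<lambda>y. \<Sum>b\<in>Basis. (g y \<bullet> b) *\<^sub>R b) has_derivative g' x) (at x)" if "x \<in> S" for x
    unfolding g'_def
    using Ck_on_has_derivative[OF Suc.prems(2) that] by (intro has_derivative_sum has_derivative_scaleR_left) auto
  then have gd: "(g has_derivative g' x) (at x)" if "x \<in> S" for x
    using that by (simp add: euclidean_representation)
  show ?case
  proof (rule Ck_on_SucI)
    fix x assume x: "x \<in> S"
    then have gx: "g x \<in> T" using assms(3) by blast
    let ?F = "frechet_derivative f (at (g x))"
    have F: "(f has_derivative ?F) (at (g x))"
      using Ck_on_has_derivative[OF Suc.prems(1) gx] .
    have "((\<lambda>x. f (g x)) has_derivative (\<lambda>v. ?F (g' x v))) (at x)"
      using has_derivative_compose[OF gd[OF x] F] .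
    moreover have "?F (g' x v) = (\<Sum>b\<in>Basis. frechet_derivative (\<lambda>x. g x \<bullet> b) (at x) v * ?F b)" for v
      using has_derivative_bounded_linear[OF F, THEN bounded_linear.linear]
      by (simp add: g'_def linear_sum linear_cmul)
    ultimately show "((\<lambda>x. f (g x)) has_derivative
       (\<lambda>v. \<Sum>b\<in>Basis. frechet_derivative (\<lambda>x. g x \<bullet> b) (at x) v * ?F b)) (at x)"
      by simp
  next
    show "Ck_on r S (\<lambda>x. \<Sum>b\<in>Basis. frechet_derivative (\<lambda>x. g x \<bullet> b) (at x) v * frechet_derivative f (at (g x)) b)" for v
    proof (intro Ck_on_sum Ck_on_mult assms(1))
      fix b :: 'e assume b: "b \<in> Basis"
      show "Ck_on r S (\<lambda>x. frechet_derivative (\<lambda>x. g x \<bullet> b) (at x) v)"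
        using Suc.prems(2)[OF b] by simp
      show "Ck_on r S (\<lambda>x. frechet_derivative f (at (g x)) b)"
      proof (rule Suc.IH)
        show "Ck_on r T (\<lambda>y. frechet_derivative f (at y) b)"
          using Suc.prems(1) by simp
      qed (use Suc.prems(2) Ck_on_mono in blast)
    qed
  qed fact
qed

lemma Ck_on_local:
  assumes "open S" "\<And>x. x \<in> S \<Longrightarrow> \<exists>T. open T \<and> x \<in> T \<and> Ck_on r T f"
  shows "Ck_on r S f"
  using assms(2)
proof (induction r arbitrary: f)
  case 0
  have "continuous (at x) f" if "x \<in> S" for x
    using 0[OF that] by (auto simp: continuous_on_eq_continuous_at)
  then show ?case by (simp add: continuous_at_imp_continuous_on)
next
  case (Suc r)
  have "f differentiable (at x)" if "x \<in> S" for x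
    using Suc.prems[OF that] by auto
  moreover have "Ck_on r S (\<lambda>x. frechet_derivative f (at x) v)" for v
    using Suc.prems by (intro Suc.IH) fastforce
  ultimately show ?case by simp
qed

lemma smooth_on_cong:
  "open S \<Longrightarrow> (\<And>x. x \<in> S \<Longrightarrow> f x = g x) \<Longrightarrow> smooth_on S f \<longleftrightarrow> smooth_on S g"
  unfolding smooth_on_def by (metis Ck_on_cong)

lemma smooth_on_subset: "smooth_on S f \<Longrightarrow> T \<subseteq> S \<Longrightarrow> smooth_on T f"
  unfolding smooth_on_def using Ck_on_subset by blast

lemma smooth_on_const: "open S \<Longrightarrow> smooth_on S (\<lambda>x. c)"
  by (simp add: smooth_on_def Ck_on_const)

lemma smooth_on_bounded_linear: "open S \<Longrightarrow> bounded_linear f \<Longrightarrow> smooth_on S f"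
  by (simp add: smooth_on_def Ck_on_bounded_linear)

lemma smooth_on_add: "open S \<Longrightarrow> smooth_on S f \<Longrightarrow> smooth_on S g \<Longrightarrow> smooth_on S (\<lambda>x. f x + g x)"
  by (simp add: smooth_on_def Ck_on_add)

lemma smooth_on_mult: "open S \<Longrightarrow> smooth_on S f \<Longrightarrow> smooth_on S g \<Longrightarrow> smooth_on S (\<lambda>x. f x * g x)"
  by (simp add: smooth_on_def Ck_on_mult)

lemma smooth_on_inverse:
  "open S \<Longrightarrow> smooth_on S f \<Longrightarrow> (\<And>x. x \<in> S \<Longrightarrow> f x \<noteq> 0) \<Longrightarrow> smooth_on S (\<lambda>x. inverse (f x))"
  by (simp add: smooth_on_def Ck_on_inverse)

lemma smooth_on_sum:
  "open S \<Longrightarrow> (\<And>i. i \<in> I \<Longrightarrow> smooth_on S (f i)) \<Longrightarrow> smooth_on S (\<lambda>x. \<Sum>i\<in>I. f i x)"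
  by (simp add: smooth_on_def Ck_on_sum)

lemma smooth_on_prod:
  "open S \<Longrightarrow> (\<And>i. i \<in> I \<Longrightarrow> smooth_on S (f i)) \<Longrightarrow> smooth_on S (\<lambda>x. \<Prod>i\<in>I. f i x)"
  by (induction I rule: infinite_finite_induct) (auto intro: smooth_on_const smooth_on_mult)

lemma smooth_on_compose:
  fixes g :: "'d::real_normed_vector \<Rightarrow> 'e::euclidean_space"
  assumes "open S" "open T" "g ` S \<subseteq> T" "smooth_on T f" "\<And>b. b \<in> Basis \<Longrightarrow> smooth_on S (\<lambda>x. g x \<bullet> b)"
  shows "smooth_on S (\<lambda>x. f (g x))"
  using assms(4,5) Ck_on_compose[OF assms(1-3)] unfolding smooth_on_def by blast

lemma smooth_on_local:
  "open S \<Longrightarrow> (\<And>x. x \<in> S \<Longrightarrow> \<exists>T. open T \<and> x \<in> T \<and> smooth_on T f) \<Longrightarrow> smooth_on S f"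
  unfolding smooth_on_def by (metis Ck_on_local)

lemma smooth_on_frechet_derivative:
  "smooth_on S f \<Longrightarrow> smooth_on S (\<lambda>x. frechet_derivative f (at x) v)"
  unfolding smooth_on_def by (metis Ck_on.simps(2))

lemma smooth_on_has_derivative:
  "smooth_on S f \<Longrightarrow> x \<in> S \<Longrightarrow> (f has_derivative frechet_derivative f (at x)) (at x)"
  unfolding smooth_on_def using Ck_on_has_derivative by blast

lemma smooth_on_imp_continuous_on: "smooth_on S f \<Longrightarrow> continuous_on S f"
  unfolding smooth_on_def by (metis Ck_on.simps(1))

section \<open>Symmetry of mixed second derivatives\<close>

lemma has_derivative_along_line:
  assumes "(f has_derivative f') (at (x + t *\<^sub>R v))"
  shows "((\<lambda>t. f (x + t *\<^sub>R v)) has_real_derivative f' v) (at t)"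
proof -
  have "((\<lambda>t. x + t *\<^sub>R v) has_derivative (\<lambda>t. t *\<^sub>R v)) (at t)"
    by (auto intro!: derivative_eq_intros)
  from has_derivative_compose[OF this assms]
  have "((\<lambda>t. f (x + t *\<^sub>R v)) has_derivative (\<lambda>t. f' v * t)) (at t)"
    using has_derivative_bounded_linear[OF assms, THEN bounded_linear.linear]
    by (simp add: linear_cmul mult.commute)
  then show ?thesis
    by (simp add: has_field_derivative_def)
qed

text \<open>Two applications of the mean value theorem: along \<open>u\<close> to the difference of
  \<open>f\<close> on two parallel segments, then along \<open>v\<close> to the resulting
  derivative. The second difference is symmetric in \<open>u\<close> and \<open>v\<close>, whereas
  the intermediate point depends on their order.\<close>

lemma second_difference_eq:
  fixes f :: "'e::real_normed_vector \<Rightarrow> real"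
  assumes f: "smooth_on (ball x e) f" and h: "0 < h" "h * (norm u + norm v) < e"
  shows "\<exists>y. dist x y \<le> h * (norm u + norm v) \<and>
    f (x + h *\<^sub>R u + h *\<^sub>R v) - f (x + h *\<^sub>R u) - f (x + h *\<^sub>R v) + f x =
    h * h * frechet_derivative (\<lambda>y. frechet_derivative f (at y) u) (at y) v"
proof -
  have b: "dist x (x + s *\<^sub>R u + t *\<^sub>R v) \<le> h * (norm u + norm v)"
    if "0 \<le> s" "s \<le> h" "0 \<le> t" "t \<le> h" for s t
  proof -
    have "norm (s *\<^sub>R u + t *\<^sub>R v) \<le> s * norm u + t * norm v"
      using norm_triangle_ineq[of "s *\<^sub>R u" "t *\<^sub>R v"] that by simp
    also have "\<dots> \<le> h * norm u + h * norm v"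
      using that by (intro add_mono mult_right_mono) auto
    finally show ?thesis
      by (simp add: dist_norm norm_minus_commute algebra_simps)
  qed
  have bb: "x + s *\<^sub>R u + t *\<^sub>R v \<in> ball x e"
    if "0 \<le> s" "s \<le> h" "0 \<le> t" "t \<le> h" for s t
    using b[OF that] h(2) by auto
  define g where "g s = f ((x + h *\<^sub>R v) + s *\<^sub>R u) - f (x + s *\<^sub>R u)" for s
  have "DERIV g s :> frechet_derivative f (at (x + h *\<^sub>R v + s *\<^sub>R u)) u - frechet_derivative f (at (x + s *\<^sub>R u)) u"
    if "0 \<le> s" "s \<le> h" for s
    unfolding g_def using bb[of s h] bb[of s 0] that h(1)
    by (intro DERIV_diff has_derivative_along_line smooth_on_has_derivative[OF f]) (auto simp: algebra_simps)
  from MVT2[OF h(1) this] obtain s where s: "0 < s" "s < h" and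
    gs: "g h - g 0 = h * (frechet_derivative f (at (x + h *\<^sub>R v + s *\<^sub>R u)) u - frechet_derivative f (at (x + s *\<^sub>R u)) u)"
    by auto
  define k where "k t = frechet_derivative f (at ((x + s *\<^sub>R u) + t *\<^sub>R v)) u" for t
  have "DERIV k t :> frechet_derivative (\<lambda>y. frechet_derivative f (at y) u) (at (x + s *\<^sub>R u + t *\<^sub>R v)) v"
    if "0 \<le> t" "t \<le> h" for t
    unfolding k_def using bb[of s t] that s
    by (intro has_derivative_along_line smooth_on_has_derivative[OF smooth_on_frechet_derivative[OF f]]) auto
  from MVT2[OF h(1) this] obtain t where t: "0 < t" "t < h" and
    kt: "k h - k 0 = h * frechet_derivative (\<lambda>y. frechet_derivative f (at y) u) (at (x + s *\<^sub>R u + t *\<^sub>R v)) v"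
    by auto
  have "g h - g 0 = h * (k h - k 0)"
    using gs by (simp add: k_def add_ac)
  then show ?thesis
    using b[of s t] s t unfolding kt by (intro exI[of _ "x + s *\<^sub>R u + t *\<^sub>R v"]) (simp add: g_def add_ac)
qed

text \<open>If the mixed derivatives differed at \<open>x\<close>, continuity would keep their
  values at points near \<open>x\<close> apart. But the same second difference equals
  \<open>h * h\<close> times one of them at \<open>y\<close> and \<open>h * h\<close> times the
  other at \<open>z\<close>, with both points close to \<open>x\<close>.\<close>

lemma frechet_derivative_commute:
  fixes f :: "'e::real_normed_vector \<Rightarrow> real"
  assumes "open S" "smooth_on S f" "x \<in> S"
  shows "frechet_derivative (\<lambda>y. frechet_derivative f (at y) u) (at x) v =
    frechet_derivative (\<lambda>y. frechet_derivative f (at y) v) (at x) u" (is "?D u v x = ?D v u x")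
proof (rule ccontr)
  let ?d = "\<bar>?D u v x - ?D v u x\<bar> / 2"
  assume "?D u v x \<noteq> ?D v u x"
  then have d: "?d > 0" by simp
  have cont: "continuous (at x) (?D u v)" for u v
    using smooth_on_imp_continuous_on[OF smooth_on_frechet_derivative[OF smooth_on_frechet_derivative[OF assms(2)]]] assms
    by (simp add: continuous_on_eq_continuous_at)
  obtain e0 where e0: "e0 > 0" "ball x e0 \<subseteq> S"
    using assms openE by blast
  obtain e1 where e1: "e1 > 0" "\<And>y. dist y x < e1 \<Longrightarrow> dist (?D u v y) (?D u v x) < ?d"
    using cont[of u v] d unfolding continuous_at_eps_delta by blast
  obtain e2 where e2: "e2 > 0" "\<And>y. dist y x < e2 \<Longrightarrow> dist (?D v u y) (?D v u x) < ?d"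
    using cont[of v u] d unfolding continuous_at_eps_delta by blast
  define e where "e = min e0 (min e1 e2)"
  have e: "e > 0" "e \<le> e0" "e \<le> e1" "e \<le> e2" using e0 e1 e2 by (auto simp: e_def)
  \<comment> \<open>The summand 1 keeps the denominator positive for vanishing \<open>u\<close> and
    \<open>v\<close> and makes the bound by \<open>e\<close> strict.\<close>
  define h where "h = e / (norm u + norm v + 1)"
  have nn: "norm u + norm v + 1 > 0" using norm_ge_zero[of u] norm_ge_zero[of v] by linarith
  have h: "h > 0" "h * (norm u + norm v) < e"
    using e(1) nn by (auto simp: h_def field_simps)
  have f: "smooth_on (ball x e) f"
    using smooth_on_subset[OF assms(2)] e0 e(2) by (meson subset_ball order_trans)
  from second_difference_eq[OF f h] obtain y where y: "dist x y \<le> h * (norm u + norm v)"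
    "f (x + h *\<^sub>R u + h *\<^sub>R v) - f (x + h *\<^sub>R u) - f (x + h *\<^sub>R v) + f x = h * h * ?D u v y" by blast
  from second_difference_eq[OF f h(1), of v u] h(2) obtain z where z: "dist x z \<le> h * (norm u + norm v)"
    "f (x + h *\<^sub>R v + h *\<^sub>R u) - f (x + h *\<^sub>R v) - f (x + h *\<^sub>R u) + f x = h * h * ?D v u z"
    by (auto simp: add.commute)
  have "x + h *\<^sub>R v + h *\<^sub>R u = x + h *\<^sub>R u + h *\<^sub>R v"
    by (simp add: add_ac)
  from z(2)[unfolded this] have "h * h * ?D u v y = h * h * ?D v u z"
    using y(2) by linarith
  then have "?D u v y = ?D v u z" using h(1) by simp
  moreover have "dist (?D u v y) (?D u v x) < ?d" "dist (?D v u z) (?D v u x) < ?d"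
    using y(1) z(1) h(2) e e1(2)[of y] e2(2)[of z] by (auto simp: dist_commute)
  ultimately show False
    by (simp add: dist_real_def abs_if split: if_splits)
qed

section \<open>Brackets given by bivectors\<close>

lemma sum_rotate3:
  "(\<Sum>x\<in>X. \<Sum>y\<in>Y. \<Sum>z\<in>Z. f x y z) = (\<Sum>z\<in>Z. \<Sum>x\<in>X. \<Sum>y\<in>Y. f x y z)"
proof -
  have "(\<Sum>x\<in>X. \<Sum>y\<in>Y. \<Sum>z\<in>Z. f x y z) = (\<Sum>x\<in>X. \<Sum>z\<in>Z. \<Sum>y\<in>Y. f x y z)"
    by (intro sum.cong refl sum.swap)
  also have "\<dots> = (\<Sum>z\<in>Z. \<Sum>x\<in>X. \<Sum>y\<in>Y. f x y z)"
    by (rule sum.swap)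
  finally show ?thesis .
qed

lemma sum_reverse4:
  "(\<Sum>x\<in>X. \<Sum>y\<in>Y. \<Sum>z\<in>Z. \<Sum>w\<in>W. f x y z w) = (\<Sum>w\<in>W. \<Sum>z\<in>Z. \<Sum>y\<in>Y. \<Sum>x\<in>X. f x y z w)"
proof -
  have "(\<Sum>x\<in>X. \<Sum>y\<in>Y. \<Sum>z\<in>Z. \<Sum>w\<in>W. f x y z w) = (\<Sum>x\<in>X. \<Sum>w\<in>W. \<Sum>y\<in>Y. \<Sum>z\<in>Z. f x y z w)"
    by (intro sum.cong refl sum_rotate3)
  also have "\<dots> = (\<Sum>w\<in>W. \<Sum>x\<in>X. \<Sum>y\<in>Y. \<Sum>z\<in>Z. f x y z w)"
    by (rule sum.swap)
  also have "\<dots> = (\<Sum>w\<in>W. \<Sum>z\<in>Z. \<Sum>y\<in>Y. \<Sum>x\<in>X. f x y z w)"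
    by (intro sum.cong refl trans[OF sum_rotate3] sum.swap)
  finally show ?thesis .
qed

text \<open>In matrix notation the terms with second derivatives are of the form \<open>f\<^sup>T P G P h\<close>, which is
  symmetric in \<open>f\<close> and \<open>h\<close> and therefore cancels in the cyclic sum.\<close>

lemma bivector_jacobi_cancellation:
  fixes f g h :: "'i::finite \<Rightarrow> real" and F G H P :: "'i \<Rightarrow> 'i \<Rightarrow> real" and Q :: "'i \<Rightarrow> 'i \<Rightarrow> 'i \<Rightarrow> real"
  assumes symm: "\<And>a b. F a b = F b a" "\<And>a b. G a b = G b a" "\<And>a b. H a b = H b a"
    and P: "\<And>a b. P a b = - P b a"
    and Q: "\<And>a b c. (\<Sum>d\<in>UNIV. P a d * Q d b c) + (\<Sum>d\<in>UNIV. P b d * Q d c a) + (\<Sum>d\<in>UNIV. P c d * Q d a b) = 0"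
  defines "E \<equiv> \<lambda>f g h G H. \<Sum>a\<in>UNIV. \<Sum>d\<in>UNIV. f a *
      (\<Sum>b\<in>UNIV. \<Sum>c\<in>UNIV. g b * h c * Q d b c + (g b * H d c + G d b * h c) * P b c) * P a d"
  shows "E f g h G H + E g h f H F + E h f g F G = 0"
proof -
  \<comment> \<open>In the application \<open>f\<close>, \<open>g\<close>, \<open>h\<close> are
    gradients, \<open>F\<close>, \<open>G\<close>, \<open>H\<close> Hessians, and
    \<open>Q d b c\<close> is the derivative of \<open>P b c\<close> in direction \<open>d\<close>.
    \<open>T\<close> collects the terms with Hessians, \<open>U\<close> those in which the bivector
    is differentiated.\<close>
  define T where "T f G h = (\<Sum>a\<in>UNIV. \<Sum>d\<in>UNIV. \<Sum>b\<in>UNIV. \<Sum>c\<in>UNIV. f a * P a d * G d b * P b c * h c)"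
    for f h :: "'i \<Rightarrow> real" and G
  define U where "U f g h = (\<Sum>a\<in>UNIV. \<Sum>b\<in>UNIV. \<Sum>c\<in>UNIV. f a * g b * h c * (\<Sum>d\<in>UNIV. P a d * Q d b c))"
    for f g h :: "'i \<Rightarrow> real"
  have E: "E f g h G H = T f G h - T f H g + U f g h" for f g h :: "'i \<Rightarrow> real" and G H
  proof -
    have "E f g h G H =
        (\<Sum>a\<in>UNIV. \<Sum>d\<in>UNIV. \<Sum>b\<in>UNIV. \<Sum>c\<in>UNIV. f a * P a d * G d b * P b c * h c) +
        (\<Sum>a\<in>UNIV. \<Sum>d\<in>UNIV. \<Sum>b\<in>UNIV. \<Sum>c\<in>UNIV. f a * P a d * H d c * P b c * g b) +
        (\<Sum>a\<in>UNIV. \<Sum>d\<in>UNIV. \<Sum>b\<in>UNIV. \<Sum>c\<in>UNIV. f a * g b * h c * (P a d * Q d b c))"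
      unfolding E_def sum_distrib_left sum_distrib_right sum.distrib[symmetric]
      by (intro sum.cong refl) (simp add: algebra_simps)
    also have "(\<Sum>a\<in>UNIV. \<Sum>d\<in>UNIV. \<Sum>b\<in>UNIV. \<Sum>c\<in>UNIV. f a * P a d * H d c * P b c * g b) = - T f H g"
    proof -
      have "(\<Sum>b\<in>UNIV. \<Sum>c\<in>UNIV. f a * P a d * H d c * P b c * g b) =
          - (\<Sum>b\<in>UNIV. \<Sum>c\<in>UNIV. f a * P a d * H d b * P b c * g c)" for a d
        unfolding sum_negf[symmetric]
        by (subst sum.swap, intro sum.cong refl) (metis (no_types, lifting) P mult_minus_left mult_minus_right)
      then show ?thesis
        unfolding T_def by (simp add: sum_negf)
    qed
    also have "(\<Sum>a\<in>UNIV. \<Sum>d\<in>UNIV. \<Sum>b\<in>UNIV. \<Sum>c\<in>UNIV. f a * g b * h c * (P a d * Q d b c)) = U f g h"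
      unfolding U_def sum_distrib_left by (intro sum.cong refl sum_rotate3[symmetric])
    finally show ?thesis
      unfolding T_def by simp
  qed
  have T: "T f G h = T h G f" if "\<And>a b. G a b = G b a" for f h :: "'i \<Rightarrow> real" and G
  proof -
    have "T f G h = (\<Sum>c\<in>UNIV. \<Sum>b\<in>UNIV. \<Sum>d\<in>UNIV. \<Sum>a\<in>UNIV. f a * P a d * G d b * P b c * h c)"
      unfolding T_def by (rule sum_reverse4)
    also have "\<dots> = T h G f"
      unfolding T_def
    proof (intro sum.cong refl)
      fix c b d a
      show "f a * P a d * G d b * P b c * h c = h c * P c b * G b d * P d a * f a"
        by (simp add: P[of a d] P[of b c] that[of d b])
    qed
    finally show ?thesis .
  qed
  have "U f g h + U g h f + U h f g = 0"
  proof -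
    have "U g h f = (\<Sum>a\<in>UNIV. \<Sum>b\<in>UNIV. \<Sum>c\<in>UNIV. g b * h c * f a * (\<Sum>d\<in>UNIV. P b d * Q d c a))"
      unfolding U_def by (rule sum_rotate3)
    moreover have "U h f g = (\<Sum>a\<in>UNIV. \<Sum>b\<in>UNIV. \<Sum>c\<in>UNIV. h c * f a * g b * (\<Sum>d\<in>UNIV. P c d * Q d a b))"
      unfolding U_def by (rule sum_rotate3[symmetric])
    ultimately have "U f g h + U g h f + U h f g =
        (\<Sum>a\<in>UNIV. \<Sum>b\<in>UNIV. \<Sum>c\<in>UNIV. f a * g b * h c *
          ((\<Sum>d\<in>UNIV. P a d * Q d b c) + (\<Sum>d\<in>UNIV. P b d * Q d c a) + (\<Sum>d\<in>UNIV. P c d * Q d a b)))"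
      unfolding U_def[of f g h] by (simp add: distrib_left sum.distrib mult_ac)
    then show ?thesis by (simp add: Q)
  qed
  \<comment> \<open>The six \<open>T\<close> terms cancel in pairs such as \<open>T f G h\<close>
    and \<open>T h G f\<close>; the three \<open>U\<close> terms vanish together by the hypothesis
    on \<open>Q\<close>.\<close>
  then show ?thesis
    unfolding E using T[of F g h] T[of G h f] T[of H f g] symm by simp
qed

text \<open>A single abstract index stands for a pair (row, column), which keeps the Jacobi
  computation free of double indices. For matrices the directions \<open>e\<close> are the
  elementary matrices.\<close>

definition bivector_bracket ::
  "('i::finite \<Rightarrow> 'e::real_normed_vector) \<Rightarrow> ('i \<Rightarrow> 'i \<Rightarrow> 'e \<Rightarrow> real) \<Rightarrow> 'e bracket" where
  "bivector_bracket e \<pi> F G x =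
     (\<Sum>a\<in>UNIV. \<Sum>b\<in>UNIV. frechet_derivative F (at x) (e a) * frechet_derivative G (at x) (e b) * \<pi> a b x)"

lemma bivector_bracket_smooth:
  assumes "open S" "smooth_on S F" "smooth_on S G" "\<And>a b. smooth_on S (\<pi> a b)"
  shows "smooth_on S (bivector_bracket e \<pi> F G)"
  unfolding bivector_bracket_def
  by (intro smooth_on_sum smooth_on_mult smooth_on_frechet_derivative assms)

lemma bivector_bracket_antisymmetric:
  assumes "\<And>a b. \<pi> a b x = - \<pi> b a x"
  shows "bivector_bracket e \<pi> F G x = - bivector_bracket e \<pi> G F x"
  unfolding bivector_bracket_def sum_negf[symmetric]
  by (subst sum.swap, intro sum.cong refl) (metis assms mult.commute mult_minus_right)

text \<open>Covers additivity, homogeneity and the Leibniz rule at once: in each of them the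
  derivative at \<open>x\<close> is a linear combination of two others.\<close>

lemma bivector_bracket_derivation:
  assumes "\<And>v. frechet_derivative K (at x) v = c * frechet_derivative F (at x) v + d * frechet_derivative G (at x) v"
  shows "bivector_bracket e \<pi> K H x = c * bivector_bracket e \<pi> F H x + d * bivector_bracket e \<pi> G H x"
  unfolding bivector_bracket_def sum_distrib_left sum.distrib[symmetric] assms
  by (simp add: algebra_simps)

text \<open>Reduces the Jacobi identity for arbitrary smooth functions to its cubic form in the
  coefficients; what remains are Hessian terms, which cancel because mixed derivatives
  commute.\<close>

lemma bivector_bracket_jacobi:
  assumes S: "open S" "x \<in> S" and smooth: "smooth_on S F" "smooth_on S G" "smooth_on S H"
    and \<pi>: "\<And>a b. smooth_on S (\<pi> a b)" "\<And>a b. \<pi> a b x = - \<pi> b a x"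
    and jac: "\<And>a b c. (\<Sum>d\<in>UNIV. \<pi> a d x * frechet_derivative (\<pi> b c) (at x) (e d)) +
        (\<Sum>d\<in>UNIV. \<pi> b d x * frechet_derivative (\<pi> c a) (at x) (e d)) +
        (\<Sum>d\<in>UNIV. \<pi> c d x * frechet_derivative (\<pi> a b) (at x) (e d)) = 0"
  shows "bivector_bracket e \<pi> F (bivector_bracket e \<pi> G H) x +
    bivector_bracket e \<pi> G (bivector_bracket e \<pi> H F) x +
    bivector_bracket e \<pi> H (bivector_bracket e \<pi> F G) x = 0"
proof -
  let ?D = "\<lambda>F. frechet_derivative F (at x)"
  let ?D2 = "\<lambda>F d b. ?D (\<lambda>y. frechet_derivative F (at y) (e b)) (e d)"
  have D: "?D (bivector_bracket e \<pi> G H) v = (\<Sum>b\<in>UNIV. \<Sum>c\<in>UNIV.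
      ?D G (e b) * ?D H (e c) * ?D (\<pi> b c) v +
      (?D G (e b) * ?D (\<lambda>y. frechet_derivative H (at y) (e c)) v +
       ?D (\<lambda>y. frechet_derivative G (at y) (e b)) v * ?D H (e c)) * \<pi> b c x)"
    if "smooth_on S G" "smooth_on S H" for G H v
  proof -
    have "(bivector_bracket e \<pi> G H has_derivative (\<lambda>v. \<Sum>b\<in>UNIV. \<Sum>c\<in>UNIV.
      ?D G (e b) * ?D H (e c) * ?D (\<pi> b c) v +
      (?D G (e b) * ?D (\<lambda>y. frechet_derivative H (at y) (e c)) v +
       ?D (\<lambda>y. frechet_derivative G (at y) (e b)) v * ?D H (e c)) * \<pi> b c x)) (at x)"
      unfolding bivector_bracket_def
      by (intro has_derivative_sum has_derivative_mult smooth_on_has_derivative[OF _ S(2)]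
          smooth_on_frechet_derivative that \<pi>)
    from fun_cong[OF frechet_derivative_at[OF this], of v, symmetric] show ?thesis .
  qed
  have symm: "?D2 F a b = ?D2 F b a" if "smooth_on S F" for F a b
    by (rule frechet_derivative_commute[OF S(1) that S(2)])
  show ?thesis
    using bivector_jacobi_cancellation[where P = "\<lambda>a b. \<pi> a b x" and Q = "\<lambda>d b c. ?D (\<pi> b c) (e d)"
        and f = "\<lambda>a. ?D F (e a)" and g = "\<lambda>a. ?D G (e a)" and h = "\<lambda>a. ?D H (e a)",
        OF symm[OF smooth(1)] symm[OF smooth(2)] symm[OF smooth(3)] \<pi>(2) jac]
    unfolding bivector_bracket_def[of e \<pi> _ "bivector_bracket e \<pi> _ _"]
      D[OF smooth(2,3)] D[OF smooth(3,1)] D[OF smooth(1,2)] .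
qed

lemma entries_bracket_eq_bivector_bracket:
  "entries_bracket UNIV c = bivector_bracket (\<lambda>(p, j). axis p (axis j 1)) (\<lambda>(p, j) (q, k). c p j q k)"
  by (intro ext) (simp add: entries_bracket_def bivector_bracket_def pderiv_entry_def
      sum.cartesian_product' flip: UNIV_Times_UNIV)

section \<open>The quadratic bracket on rectangular matrices\<close>

lemma matrix_eq_sum_axis:
  fixes V :: "real^'c^'r"
  shows "V = (\<Sum>p\<in>UNIV. \<Sum>j\<in>UNIV. (V $ p $ j) *\<^sub>R axis p (axis j 1))"
proof -
  have "(\<Sum>j\<in>UNIV. (V $ p $ j) *\<^sub>R axis p (axis j 1)) = axis p (V $ p)" for p
    by (simp add: vec_eq_iff axis_def if_distrib[of "\<lambda>x. c * x" for c] cong: if_cong)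
  then have "(\<Sum>p\<in>UNIV. \<Sum>j\<in>UNIV. (V $ p $ j) *\<^sub>R axis p (axis j 1)) = (\<Sum>p\<in>UNIV. axis p (V $ p))"
    by (simp only:)
  also have "\<dots> = V"
    by (simp add: vec_eq_iff axis_def if_distrib[of "\<lambda>x. x $ i" for i] cong: if_cong)
  finally show ?thesis by simp
qed

lemma linear_eq_sum_entries:
  fixes L :: "real^'c^'r \<Rightarrow> real"
  assumes "linear L"
  shows "L V = (\<Sum>p\<in>UNIV. \<Sum>j\<in>UNIV. V $ p $ j * L (axis p (axis j 1)))"
  by (subst matrix_eq_sum_axis[of V])
    (simp add: linear_sum[OF assms] linear_cmul[OF assms])

lemma bounded_linear_entry: "bounded_linear (\<lambda>X::real^'c^'r. X $ p $ j)"
  by (rule bounded_linear_compose[OF bounded_linear_vec_nth bounded_linear_vec_nth])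

lemma smooth_on_entry: "open S \<Longrightarrow> smooth_on S (\<lambda>X::real^'c^'r. X $ p $ j)"
  by (rule smooth_on_bounded_linear[OF _ bounded_linear_entry])

lemma has_derivative_entry: "((\<lambda>X::real^'c^'r. X $ p $ j) has_derivative (\<lambda>V. V $ p $ j)) F"
  by (rule bounded_linear_imp_has_derivative[OF bounded_linear_entry])

lemma smooth_on_compose_matrix:
  fixes g :: "'d::real_normed_vector \<Rightarrow> real^'c^'r"
  assumes "open S" "open T" "g ` S \<subseteq> T" "smooth_on T f" "\<And>p j. smooth_on S (\<lambda>x. g x $ p $ j)"
  shows "smooth_on S (\<lambda>x. f (g x))"
  by (rule smooth_on_compose[OF assms(1-4)]) (auto simp: Basis_vec_def inner_axis assms(5))

text \<open>The formula of \<open>GL_coeff\<close> with free constants and independent row and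
  column types, so that one formula serves \<open>k\<close> by \<open>k\<close>, \<open>k\<close> by
  \<open>n\<close> and \<open>n\<close> by \<open>n\<close> matrices.\<close>

definition mat_coeff ::
  "real \<Rightarrow> real \<Rightarrow> 'r::{finite,linorder} \<Rightarrow> 'c::{finite,linorder} \<Rightarrow> 'r \<Rightarrow> 'c \<Rightarrow>
   real^'c::{finite,linorder}^'r::{finite,linorder} \<Rightarrow> real" where
  "mat_coeff a b p j q k X =
     a * ((sign_diff q p + sign_diff k j) * (X $ p $ k * X $ q $ j)) +
     b * ((sign_diff q p - sign_diff k j) * (X $ p $ j * X $ q $ k))"

lemma sign_diff_self [simp]: "sign_diff p p = 0"
  by (simp add: sign_diff_def)

lemma sign_diff_swap: "sign_diff p q = - sign_diff q p"
  by (auto simp: sign_diff_def)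

text \<open>Write \<open>x\<close>, \<open>y\<close>, \<open>z\<close> for the signs of the steps
  from \<open>p\<close> to \<open>q\<close>, \<open>q\<close> to \<open>r\<close> and
  \<open>p\<close> to \<open>r\<close>; the left side is \<open>x * y - z * (x + y)\<close>. If
  \<open>x = y\<close> is nonzero, then \<open>z = x\<close> and the value is \<open>1 - 2\<close>;
  if \<open>x = - y\<close> is nonzero, it is \<open>-1 - 0\<close>; if just one of
  \<open>x\<close>, \<open>y\<close> is zero, \<open>z\<close> equals the other.\<close>

lemma sign_diff_cyclic:
  "\<not> (p = q \<and> q = r) \<Longrightarrow>
    sign_diff q p * sign_diff r q - sign_diff r p * sign_diff r q - sign_diff q p * sign_diff r p = -1"
  by (auto simp: sign_diff_def)

lemma mat_coeff_antisymmetric: "mat_coeff a b p j q k X = - mat_coeff a b q k p j X"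
  by (simp add: mat_coeff_def sign_diff_swap[of p q] sign_diff_swap[of j k] algebra_simps)

lemma mat_coeff_smooth: "open S \<Longrightarrow> smooth_on S (mat_coeff a b p j q k)"
  unfolding mat_coeff_def[abs_def]
  by (intro smooth_on_add smooth_on_mult smooth_on_const smooth_on_entry)

lemma mat_coeff_has_derivative:
  "(mat_coeff a b p j q k has_derivative
     (\<lambda>V. a * ((sign_diff q p + sign_diff k j) * (X $ p $ k * V $ q $ j + V $ p $ k * X $ q $ j)) +
      b * ((sign_diff q p - sign_diff k j) * (X $ p $ j * V $ q $ k + V $ p $ j * X $ q $ k)))) (at X)"
  unfolding mat_coeff_def[abs_def]
  by (intro has_derivative_add has_derivative_mult_right has_derivative_mult has_derivative_entry)

text \<open>Each of the two sign expressions on the right-hand side is \<open>-1\<close> unless its three indices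
  coincide, and in that case the cubic factor vanishes. The letters \<open>a\<close>, \<open>b\<close>, \<open>c\<close> in the subscripts
  number the three rows and columns.\<close>

lemma quadratic_bracket_jacobi_identity:
  fixes a b sab sac sbc tab tac tbc :: real and xaa xab xac xba xbb xbc xca xcb xcc :: real
  defines "\<pi> \<equiv> \<lambda>s t xpj xpk xqj xqk. a * ((s + t) * (xpk * xqj)) + b * ((s - t) * (xpj * xqk))"
  defines "d\<pi> \<equiv> \<lambda>s t xpj xpk xqj xqk vpj vpk vqj vqk.
     a * ((s + t) * (xpk * vqj + vpk * xqj)) + b * ((s - t) * (xpj * vqk + vpj * xqk))"
  shows "d\<pi> sbc tbc xbb xbc xcb xcc
       (\<pi> sab tab xaa xab xba xbb) (\<pi> sab tac xaa xac xba xbc)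
       (\<pi> sac tab xaa xab xca xcb) (\<pi> sac tac xaa xac xca xcc) +
     d\<pi> (- sac) (- tac) xcc xca xac xaa
       (\<pi> sbc tbc xbb xbc xcb xcc) (\<pi> sbc (- tab) xbb xba xcb xca)
       (\<pi> (- sab) tbc xbb xbc xab xac) (\<pi> (- sab) (- tab) xbb xba xab xaa) +
     d\<pi> sab tab xaa xab xba xbb
       (\<pi> (- sac) (- tac) xcc xca xac xaa) (\<pi> (- sac) (- tbc) xcc xcb xac xab)
       (\<pi> (- sbc) (- tac) xcc xca xbc xba) (\<pi> (- sbc) (- tbc) xcc xcb xbc xbb) =
     a * a * ((sab * sbc - sac * sbc - sab * sac) - (tab * tbc - tac * tbc - tab * tac)) *
       (xac * xba * xcb - xab * xbc * xca)"
  \<comment> \<open>A polynomial identity in freely varying signs and entries; the relations among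
    actual signs enter only later, through \<open>sign_diff_cyclic\<close>.\<close>
  unfolding \<pi>_def d\<pi>_def by algebra

text \<open>Each sum over \<open>d\<close> is the derivative of a coefficient along a vector field,
  and it only involves entries in three rows and three columns. This turns the claim into the
  polynomial identity above.\<close>

lemma mat_coeff_jacobi:
  fixes X :: "real^'c::{finite,linorder}^'r::{finite,linorder}" and a b :: real
  defines "\<pi> \<equiv> \<lambda>(p, j) (q, k). mat_coeff a b p j q k"
    and "e \<equiv> \<lambda>(p::'r, j::'c). axis p (axis j (1::real))"
  shows "(\<Sum>d\<in>UNIV. \<pi> A d X * frechet_derivative (\<pi> B C) (at X) (e d)) +
    (\<Sum>d\<in>UNIV. \<pi> B d X * frechet_derivative (\<pi> C A) (at X) (e d)) +
    (\<Sum>d\<in>UNIV. \<pi> C d X * frechet_derivative (\<pi> A B) (at X) (e d)) = 0"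
proof -
  \<comment> \<open>The matrix of brackets of the entry \<open>A\<close> with all entries: up to
    sign, its Hamiltonian vector field.\<close>
  define v where "v A = (\<chi> q k. \<pi> A (q, k) X)" for A
  have contract: "(\<Sum>d\<in>UNIV. \<pi> A d X * L (e d)) = L (v A)" if "linear L" 
    for A and L :: "real^'c::{finite,linorder}^'r::{finite,linorder} \<Rightarrow> real"
    unfolding linear_eq_sum_entries[OF that, of "v A"]
    by (simp add: sum.cartesian_product' v_def e_def flip: UNIV_Times_UNIV)
  have D: "frechet_derivative (\<pi> (p, j) (q, k)) (at X) =
     (\<lambda>V. a * ((sign_diff q p + sign_diff k j) * (X $ p $ k * V $ q $ j + V $ p $ k * X $ q $ j)) +
      b * ((sign_diff q p - sign_diff k j) * (X $ p $ j * V $ q $ k + V $ p $ j * X $ q $ k)))" for p j q k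
    unfolding \<pi>_def prod.case by (rule frechet_derivative_at[OF mat_coeff_has_derivative, symmetric])
  have lin: "linear (frechet_derivative (\<pi> A B) (at X))" for A B
    using linear_frechet_derivative[OF differentiableI[OF mat_coeff_has_derivative]]
    by (cases A; cases B) (simp add: \<pi>_def)
  obtain p1 j1 p2 j2 p3 j3 where ABC: "A = (p1, j1)" "B = (p2, j2)" "C = (p3, j3)"
    by (metis surj_pair)
  define x where "x p j = X $ p $ j" for p j
  have minus_swap: "- u - v = - v - u" for u v :: real
    by simp
  let ?es = "\<lambda>p q r. sign_diff q p * sign_diff r q - sign_diff r p * sign_diff r q - sign_diff q p * sign_diff r p"
  have "(\<Sum>d\<in>UNIV. \<pi> A d X * frechet_derivative (\<pi> B C) (at X) (e d)) +
    (\<Sum>d\<in>UNIV. \<pi> B d X * frechet_derivative (\<pi> C A) (at X) (e d)) +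
    (\<Sum>d\<in>UNIV. \<pi> C d X * frechet_derivative (\<pi> A B) (at X) (e d)) =
    a * a * (?es p1 p2 p3 - ?es j1 j2 j3) * (x p1 j3 * x p2 j1 * x p3 j2 - x p1 j2 * x p2 j3 * x p3 j1)"
    unfolding contract[OF lin] ABC quadratic_bracket_jacobi_identity[symmetric, where b = b and xaa = "x p1 j1"
      and xbb = "x p2 j2" and xcc = "x p3 j3"]
    unfolding D by (simp add: v_def \<pi>_def mat_coeff_def x_def
      sign_diff_swap[of p1 p2] sign_diff_swap[of p1 p3] sign_diff_swap[of p2 p3]
      sign_diff_swap[of j1 j2] sign_diff_swap[of j1 j3] sign_diff_swap[of j2 j3] minus_swap)
  also have "\<dots> = 0"
  proof (cases "(p1 = p2 \<and> p2 = p3) \<or> (j1 = j2 \<and> j2 = j3)")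
    case True
    then show ?thesis by auto
  next
    case False
    then have "?es p1 p2 p3 = -1" "?es j1 j2 j3 = -1"
      using sign_diff_cyclic[of p1 p2 p3] sign_diff_cyclic[of j1 j2 j3] by blast+
    then show ?thesis by simp
  qed
  finally show ?thesis .
qed

section \<open>The Poisson axioms for the quadratic bracket\<close>

abbreviation mat_bracket ::
  "real \<Rightarrow> real \<Rightarrow> (real^'c::{finite,linorder}^'r::{finite,linorder}) bracket" where
  "mat_bracket a b \<equiv> entries_bracket UNIV (mat_coeff a b)"

lemma mat_bracket_smooth:
  "open S \<Longrightarrow> smooth_on S F \<Longrightarrow> smooth_on S G \<Longrightarrow> smooth_on S (mat_bracket a b F G)"
  unfolding entries_bracket_eq_bivector_bracket
  by (rule bivector_bracket_smooth) (auto intro: mat_coeff_smooth)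

lemma mat_bracket_antisymmetric: "mat_bracket a b F G X = - mat_bracket a b G F X"
  unfolding entries_bracket_eq_bivector_bracket
  by (rule bivector_bracket_antisymmetric) (auto intro: mat_coeff_antisymmetric)

lemma mat_bracket_jacobi:
  assumes "open S" "X \<in> S" "smooth_on S F" "smooth_on S G" "smooth_on S H"
  shows "mat_bracket a b F (mat_bracket a b G H) X + mat_bracket a b G (mat_bracket a b H F) X +
    mat_bracket a b H (mat_bracket a b F G) X = 0"
  unfolding entries_bracket_eq_bivector_bracket
  by (rule bivector_bracket_jacobi[OF assms _ _ mat_coeff_jacobi])
    (auto intro: mat_coeff_smooth[OF assms(1)] mat_coeff_antisymmetric)

lemma mat_bracket_derivation:
  assumes "\<And>v. frechet_derivative K (at X) v = c * frechet_derivative F (at X) v + d * frechet_derivative G (at X) v"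
  shows "mat_bracket a b K H X = c * mat_bracket a b F H X + d * mat_bracket a b G H X"
  unfolding entries_bracket_eq_bivector_bracket by (rule bivector_bracket_derivation) (rule assms)

lemma mat_bracket_add:
  assumes "X \<in> S" "smooth_on S F" "smooth_on S G"
  shows "mat_bracket a b (\<lambda>u. F u + G u) H X = mat_bracket a b F H X + mat_bracket a b G H X"
proof -
  have "frechet_derivative (\<lambda>u. F u + G u) (at X) =
      (\<lambda>v. frechet_derivative F (at X) v + frechet_derivative G (at X) v)"
    by (rule frechet_derivative_at[symmetric])
      (intro has_derivative_add smooth_on_has_derivative[OF _ assms(1)] assms)
  then show ?thesis
    using mat_bracket_derivation[of "\<lambda>u. F u + G u" X 1 F 1 G] by simp
qed

lemma mat_bracket_mult:
  assumes "X \<in> S" "smooth_on S F" "smooth_on S G"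
  shows "mat_bracket a b (\<lambda>u. F u * G u) H X = F X * mat_bracket a b G H X + mat_bracket a b F H X * G X"
proof -
  have "frechet_derivative (\<lambda>u. F u * G u) (at X) =
      (\<lambda>v. F X * frechet_derivative G (at X) v + frechet_derivative F (at X) v * G X)"
    by (rule frechet_derivative_at[symmetric])
      (intro has_derivative_mult smooth_on_has_derivative[OF _ assms(1)] assms)
  then show ?thesis
    using mat_bracket_derivation[of "\<lambda>u. F u * G u" X "F X" G "G X" F] by (simp add: mult.commute)
qed

lemma mat_bracket_cmult:
  assumes "X \<in> S" "smooth_on S F"
  shows "mat_bracket a b (\<lambda>u. c * F u) H X = c * mat_bracket a b F H X"
proof -
  have "frechet_derivative (\<lambda>u. c * F u) (at X) = (\<lambda>v. c * frechet_derivative F (at X) v)"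
    by (rule frechet_derivative_at[symmetric])
      (intro has_derivative_mult_right smooth_on_has_derivative[OF _ assms(1)] assms)
  then show ?thesis
    using mat_bracket_derivation[of "\<lambda>u. c * F u" X c F 0 F] by simp
qed

lemma entries_bracket_cong:
  fixes F G F' G' :: "real^'c::finite^'r::finite \<Rightarrow> real"
  assumes "open S" "X \<in> S" "\<And>Y. Y \<in> S \<Longrightarrow> F Y = F' Y" "\<And>Y. Y \<in> S \<Longrightarrow> G Y = G' Y"
  shows "entries_bracket J c F G X = entries_bracket J c F' G' X"
proof -
  have "frechet_derivative F (at X) = frechet_derivative F' (at X)"
    if "\<And>Y. Y \<in> S \<Longrightarrow> F Y = F' Y" for F F' :: "real^'c::finite^'r::finite \<Rightarrow> real"
  proof -
    \<comment> \<open>\<open>frechet_derivative\<close> is a choice among the derivatives;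
      equivalent predicates give equal choices, whether or not \<open>F\<close> is
      differentiable.\<close>
    have "(F has_derivative D) (at X) \<longleftrightarrow> (F' has_derivative D) (at X)" for D
      using has_derivative_transform_within_open[OF _ assms(1,2), of F D UNIV F']
        has_derivative_transform_within_open[OF _ assms(1,2), of F' D UNIV F] that by auto
    then show ?thesis unfolding frechet_derivative_def by simp
  qed
  from this[OF assms(3)] this[OF assms(4)] show ?thesis
    by (simp add: entries_bracket_def pderiv_entry_def)
qed

section \<open>Multiplicativity\<close>

lemma sum_reorder6_rows:
  "(\<Sum>p\<in>P. \<Sum>l\<in>L. \<Sum>q\<in>Q. \<Sum>m\<in>M. \<Sum>j\<in>J. \<Sum>k\<in>K. f p l q m j k) =
    (\<Sum>p\<in>P. \<Sum>j\<in>J. \<Sum>q\<in>Q. \<Sum>k\<in>K. \<Sum>l\<in>L. \<Sum>m\<in>M. f p l q m j k)"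
  unfolding sum.cartesian_product
  by (rule sum.reindex_bij_witness[of _ "\<lambda>(p, j, q, k, l, m). (p, l, q, m, j, k)" "\<lambda>(p, l, q, m, j, k). (p, j, q, k, l, m)"])
    auto

lemma sum_reorder6_columns:
  "(\<Sum>l\<in>L. \<Sum>j\<in>J. \<Sum>m\<in>M. \<Sum>k\<in>K. \<Sum>p\<in>P. \<Sum>q\<in>Q. f l j m k p q) =
    (\<Sum>p\<in>P. \<Sum>j\<in>J. \<Sum>q\<in>Q. \<Sum>k\<in>K. \<Sum>l\<in>L. \<Sum>m\<in>M. f l j m k p q)"
  unfolding sum.cartesian_product
  by (rule sum.reindex_bij_witness[of _ "\<lambda>(p, j, q, k, l, m). (l, j, m, k, p, q)" "\<lambda>(l, j, m, k, p, q). (p, j, q, k, l, m)"])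
    auto

text \<open>The outer signs \<open>s\<close> and \<open>t\<close> reproduce the formula for the
  product. \<open>T1\<close> and \<open>T2\<close> carry the signs of the summed indices: they occur
  with factors \<open>a\<close> and \<open>-b\<close> in the first sum and with \<open>-a\<close>
  and \<open>b\<close> in the second, so they cancel.\<close>

lemma mat_coeff_matrix_mult:
  fixes X :: "real^'m::{finite,linorder}^'r::{finite,linorder}" and A :: "real^'c::{finite,linorder}^'m::{finite,linorder}"
  shows "mat_coeff a b p j q k (X ** A) =
    (\<Sum>l\<in>UNIV. \<Sum>m\<in>UNIV. A $ l $ j * A $ m $ k * mat_coeff a b p l q m X) +
    (\<Sum>l\<in>UNIV. \<Sum>m\<in>UNIV. X $ p $ l * X $ q $ m * mat_coeff a b l j m k A)"
proof -
  define s t where "s = sign_diff q p" and "t = sign_diff k j"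
  define T1 where "T1 = (\<Sum>l\<in>UNIV. \<Sum>m\<in>UNIV. sign_diff m l * (A $ l $ j * A $ m $ k * (X $ p $ m * X $ q $ l)))"
  define T2 where "T2 = (\<Sum>l\<in>UNIV. \<Sum>m\<in>UNIV. sign_diff m l * (A $ l $ j * A $ m $ k * (X $ p $ l * X $ q $ m)))"
  define S1 where "S1 = (\<Sum>l\<in>UNIV. \<Sum>m\<in>UNIV. A $ l $ j * A $ m $ k * (X $ p $ m * X $ q $ l))"
  define S2 where "S2 = (\<Sum>l\<in>UNIV. \<Sum>m\<in>UNIV. A $ l $ j * A $ m $ k * (X $ p $ l * X $ q $ m))"
  have S1: "S1 = (X ** A) $ p $ k * (X ** A) $ q $ j"
  proof -
    have "S1 = (X ** A) $ q $ j * (X ** A) $ p $ k"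
      unfolding S1_def matrix_matrix_mult_def vec_lambda_beta sum_product
      by (intro sum.cong refl) (simp add: mult_ac)
    then show ?thesis
      by (simp only: mult.commute)
  qed
  have S2: "S2 = (X ** A) $ p $ j * (X ** A) $ q $ k"
    unfolding S2_def matrix_matrix_mult_def by (simp add: sum_product mult_ac)
  have T1': "(\<Sum>l\<in>UNIV. \<Sum>m\<in>UNIV. sign_diff m l * (X $ p $ l * X $ q $ m * (A $ l $ k * A $ m $ j))) = - T1"
    unfolding T1_def sum_negf[symmetric]
  proof (subst sum.swap, intro sum.cong refl)
    fix l m :: 'm
    show "sign_diff l m * (X $ p $ m * X $ q $ l * (A $ m $ k * A $ l $ j)) =
      - (sign_diff m l * (A $ l $ j * A $ m $ k * (X $ p $ m * X $ q $ l)))"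
      by (simp add: sign_diff_swap[of l m] mult_ac)
  qed
  have S1': "(\<Sum>l\<in>UNIV. \<Sum>m\<in>UNIV. X $ p $ l * X $ q $ m * (A $ l $ k * A $ m $ j)) = S1"
    unfolding S1_def by (subst sum.swap) (simp add: mult_ac)
  have "(\<Sum>l\<in>UNIV. \<Sum>m\<in>UNIV. A $ l $ j * A $ m $ k * mat_coeff a b p l q m X) =
      a * s * S1 + a * T1 + b * s * S2 - b * T2"
    unfolding S1_def S2_def T1_def T2_def mat_coeff_def s_def sum_distrib_left
      sum.distrib[symmetric] sum_subtractf[symmetric]
    by (intro sum.cong refl) (simp add: algebra_simps)
  moreover have "(\<Sum>l\<in>UNIV. \<Sum>m\<in>UNIV. X $ p $ l * X $ q $ m * mat_coeff a b l j m k A) =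
      a * (- T1) + a * t * S1 + b * T2 - b * t * S2"
    unfolding S1'[symmetric] T1'[symmetric] unfolding S2_def T2_def mat_coeff_def t_def sum_distrib_left
      sum.distrib[symmetric] sum_subtractf[symmetric]
    by (intro sum.cong refl) (simp add: algebra_simps)
  ultimately show ?thesis
    unfolding mat_coeff_def[of a b p j q k "X ** A"] S1[symmetric] S2[symmetric] s_def[symmetric] t_def[symmetric]
    by (simp add: algebra_simps)
qed

lemma bounded_linear_matrix_mult_left: "bounded_linear (\<lambda>U::real^'m^'r. U ** (A::real^'c^'m))"
  by (subst linear_conv_bounded_linear[symmetric])
    (auto intro!: linearI simp: vec_eq_iff matrix_matrix_mult_def algebra_simps sum.distrib sum_distrib_left)

lemma bounded_linear_matrix_mult_right: "bounded_linear (\<lambda>V::real^'c^'m. (X::real^'m^'r) ** V)"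
  by (subst linear_conv_bounded_linear[symmetric])
    (auto intro!: linearI simp: vec_eq_iff matrix_matrix_mult_def algebra_simps sum.distrib sum_distrib_left)

section \<open>The chain rule along matrix products\<close>

lemma pderiv_entry_compose_linear:
  fixes L :: "real^'d^'s \<Rightarrow> real^'c^'r"
  assumes "F differentiable (at (L X))" "(L has_derivative L') (at X)"
  shows "pderiv_entry (\<lambda>U. F (L U)) p l X = (\<Sum>q\<in>UNIV. \<Sum>j\<in>UNIV. L' (axis p (axis l 1)) $ q $ j * pderiv_entry F q j (L X))"
proof -
  have F: "(F has_derivative frechet_derivative F (at (L X))) (at (L X))"
    using assms(1) by (simp add: frechet_derivative_works)
  have "frechet_derivative (\<lambda>U. F (L U)) (at X) = (\<lambda>v. frechet_derivative F (at (L X)) (L' v))"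
    by (rule frechet_derivative_at[symmetric]) (rule has_derivative_compose[OF assms(2) F])
  then show ?thesis
    unfolding pderiv_entry_def
    by (simp add: linear_eq_sum_entries[OF linear_frechet_derivative[OF assms(1)], of "L' _"])
qed

lemma axis_axis_matrix_mult:
  "(axis p (axis l 1) ** A) $ q $ j = (if q = p then A $ l $ j else (0::real))"
  by (simp add: matrix_matrix_mult_def axis_def if_distrib[of "\<lambda>x. x * y" for y] cong: if_cong)

lemma matrix_mult_axis_axis:
  "(X ** axis l (axis j 1)) $ p $ k = (if k = j then X $ p $ l else (0::real))"
  by (simp add: matrix_matrix_mult_def axis_def if_distrib[of "\<lambda>x. x $ y" for y] if_distrib[of "\<lambda>x. y * x" for y] cong: if_cong)

lemma pderiv_entry_matrix_mult_left:
  assumes "F differentiable (at (X ** A))"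
  shows "pderiv_entry (\<lambda>U. F (U ** A)) p l X = (\<Sum>j\<in>UNIV. A $ l $ j * pderiv_entry F p j (X ** A))"
proof -
  have "(\<Sum>j\<in>UNIV. (axis p (axis l 1) ** A) $ q $ j * pderiv_entry F q j (X ** A)) =
    (if q = p then \<Sum>j\<in>UNIV. A $ l $ j * pderiv_entry F p j (X ** A) else 0)" for q
    by (simp add: axis_axis_matrix_mult)
  then show ?thesis
    by (simp add: pderiv_entry_compose_linear[OF assms bounded_linear_imp_has_derivative[OF bounded_linear_matrix_mult_left]])
qed

lemma pderiv_entry_matrix_mult_right:
  assumes "F differentiable (at (X ** A))"
  shows "pderiv_entry (\<lambda>V. F (X ** V)) l j A = (\<Sum>p\<in>UNIV. X $ p $ l * pderiv_entry F p j (X ** A))"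
proof -
  have "(\<Sum>k\<in>UNIV. (X ** axis l (axis j 1)) $ p $ k * pderiv_entry F p k (X ** A)) =
    X $ p $ l * pderiv_entry F p j (X ** A)" for p
    by (simp add: matrix_mult_axis_axis if_distrib[of "\<lambda>x. x * y" for y] cong: if_cong)
  then show ?thesis
    by (simp add: pderiv_entry_compose_linear[OF assms bounded_linear_imp_has_derivative[OF bounded_linear_matrix_mult_right]])
qed

text \<open>By the chain rule both brackets on the right become sums over the same derivatives of
  \<open>F\<close> and \<open>G\<close> at \<open>X ** A\<close>; their coefficients add up by
  \<open>mat_coeff_matrix_mult\<close>.\<close>

lemma mat_bracket_matrix_mult:
  assumes "F differentiable (at (X ** A))" "G differentiable (at (X ** A))"
  shows "mat_bracket a b F G (X ** A) =
    mat_bracket a b (\<lambda>U. F (U ** A)) (\<lambda>U. G (U ** A)) X + mat_bracket a b (\<lambda>V. F (X ** V)) (\<lambda>V. G (X ** V)) A"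
proof -
  let ?F = "\<lambda>p j. pderiv_entry F p j (X ** A)" and ?G = "\<lambda>p j. pderiv_entry G p j (X ** A)"
  have expand: "(\<Sum>i\<in>I. f i) * (\<Sum>j\<in>J. g j) * c = (\<Sum>i\<in>I. \<Sum>j\<in>J. f i * g j * c)"
    for I :: "'x set" and J :: "'y set" and f g and c :: real
    by (subst sum_product) (simp only: sum_distrib_right)
  have "mat_bracket a b (\<lambda>U. F (U ** A)) (\<lambda>U. G (U ** A)) X =
    (\<Sum>p\<in>UNIV. \<Sum>l\<in>UNIV. \<Sum>q\<in>UNIV. \<Sum>m\<in>UNIV. \<Sum>j\<in>UNIV. \<Sum>k\<in>UNIV.
      ?F p j * ?G q k * (A $ l $ j * A $ m $ k * mat_coeff a b p l q m X))"
    unfolding entries_bracket_def pderiv_entry_matrix_mult_left[OF assms(1)] pderiv_entry_matrix_mult_left[OF assms(2)]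
      expand
    by (intro sum.cong refl) (simp add: mult_ac)
  also have "\<dots> = (\<Sum>p\<in>UNIV. \<Sum>j\<in>UNIV. \<Sum>q\<in>UNIV. \<Sum>k\<in>UNIV. \<Sum>l\<in>UNIV. \<Sum>m\<in>UNIV.
      ?F p j * ?G q k * (A $ l $ j * A $ m $ k * mat_coeff a b p l q m X))"
    by (rule sum_reorder6_rows)
  finally have 1: "mat_bracket a b (\<lambda>U. F (U ** A)) (\<lambda>U. G (U ** A)) X =
    (\<Sum>p\<in>UNIV. \<Sum>j\<in>UNIV. \<Sum>q\<in>UNIV. \<Sum>k\<in>UNIV. ?F p j * ?G q k *
      (\<Sum>l\<in>UNIV. \<Sum>m\<in>UNIV. A $ l $ j * A $ m $ k * mat_coeff a b p l q m X))"
    by (simp only: sum_distrib_left)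
  have "mat_bracket a b (\<lambda>V. F (X ** V)) (\<lambda>V. G (X ** V)) A =
    (\<Sum>l\<in>UNIV. \<Sum>j\<in>UNIV. \<Sum>m\<in>UNIV. \<Sum>k\<in>UNIV. \<Sum>p\<in>UNIV. \<Sum>q\<in>UNIV.
      ?F p j * ?G q k * (X $ p $ l * X $ q $ m * mat_coeff a b l j m k A))"
    unfolding entries_bracket_def pderiv_entry_matrix_mult_right[OF assms(1)] pderiv_entry_matrix_mult_right[OF assms(2)]
      expand
    by (intro sum.cong refl) (simp add: mult_ac)
  also have "\<dots> = (\<Sum>p\<in>UNIV. \<Sum>j\<in>UNIV. \<Sum>q\<in>UNIV. \<Sum>k\<in>UNIV. \<Sum>l\<in>UNIV. \<Sum>m\<in>UNIV.
      ?F p j * ?G q k * (X $ p $ l * X $ q $ m * mat_coeff a b l j m k A))"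
    by (rule sum_reorder6_columns)
  finally have 2: "mat_bracket a b (\<lambda>V. F (X ** V)) (\<lambda>V. G (X ** V)) A =
    (\<Sum>p\<in>UNIV. \<Sum>j\<in>UNIV. \<Sum>q\<in>UNIV. \<Sum>k\<in>UNIV. ?F p j * ?G q k *
      (\<Sum>l\<in>UNIV. \<Sum>m\<in>UNIV. X $ p $ l * X $ q $ m * mat_coeff a b l j m k A))"
    by (simp only: sum_distrib_left)
  show ?thesis
    unfolding 1 2 entries_bracket_def[of UNIV "mat_coeff a b" F G] mat_coeff_matrix_mult
    by (simp only: distrib_left sum.distrib)
qed

section \<open>Restriction to a cell\<close>

lemma cyc_iff: "xs \<noteq> [] \<Longrightarrow> cyc xs \<longleftrightarrow> (\<exists>m<length xs. sorted_wrt (<) (rotate m xs))"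
  unfolding cyc_def by (metis length_greater_0_conv mod_less_divisor rotate_conv_mod)

lemma cyc_3: "cyc [a, b, c] \<longleftrightarrow> a < b \<and> b < c \<or> b < c \<and> c < a \<or> c < a \<and> a < b"
  by (simp add: cyc_iff Ex_less_Suc sorted_wrt1 sorted_wrt2[OF transp_on_less]
      del: sorted_wrt.simps(2)) argo

lemma cyc_4: "cyc [a, b, c, d] \<longleftrightarrow> a < b \<and> b < c \<and> c < d \<or> b < c \<and> c < d \<and> d < a \<or>
    c < d \<and> d < a \<and> a < b \<or> d < a \<and> a < b \<and> b < c"
  by (simp add: cyc_iff Ex_less_Suc sorted_wrt1 sorted_wrt2[OF transp_on_less]
      del: sorted_wrt.simps(2)) argo


text \<open>The sum counts ascents minus descents on the closed walk from \<open>i\<close> via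
  \<open>i'\<close>, \<open>j'\<close>, \<open>j\<close> back to \<open>i\<close>. Four distinct
  points in cyclic order give 2, in reverse order -2, otherwise 0. One coincidence leaves a walk
  through three points, which gives 1 or -1; two coincidences leave 0.\<close>

lemma s_par_eq:
  assumes "i \<noteq> j" "i \<noteq> j'" "i' \<noteq> j" "i' \<noteq> j'"
  shows "s_par i j i' j' = (sign_diff i' i + sign_diff j' i' + sign_diff j j' + sign_diff i j) / 2"
proof -
  \<comment> \<open>Trichotomy is stated with all order literals decided, so that each case
    simplifies completely; \<open>ac\<close> discards the combinations that violate
    transitivity.\<close>
  have tri: "a < b \<and> \<not> b < a \<and> a \<noteq> b \<and> b \<noteq> a \<or> b < a \<and> \<not> a < b \<and> a \<noteq> b \<and> b \<noteq> a \<or> a = b" for a b :: 'a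
    by auto
  have ac: "\<not> (a < b \<and> b < c \<and> c < a)" for a b c :: 'a
    by auto
  show ?thesis
    unfolding s_par_def cyc_3 cyc_4 sign_diff_def
    using assms tri[of i i'] tri[of j j'] tri[of i j] tri[of i j'] tri[of i' j] tri[of i' j']
      ac[of i i' j] ac[of i j i'] ac[of i i' j'] ac[of i j' i'] ac[of i j j'] ac[of i j' j] ac[of i' j j'] ac[of i' j' j]
    by (elim disjE conjE) (simp_all (no_asm_simp))
qed

lemma s_cross_eq_s_par: "s_cross i j i' j' = s_par i' j i j'"
  unfolding s_cross_def s_par_def by (cases "i = i'"; cases "j = j'") auto

section \<open>Open sets of invertible matrices and infinitesimal invariance\<close>

lemma smooth_on_det:
  assumes "open S" "\<And>i j. smooth_on S (\<lambda>x. g x $ i $ j)"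
  shows "smooth_on S (\<lambda>x. det (g x))"
  unfolding det_def by (intro smooth_on_sum smooth_on_mult smooth_on_prod smooth_on_const assms)

lemma open_preimage_invertible:
  assumes "\<And>i j. smooth_on UNIV (\<lambda>x. g x $ i $ j)"
  shows "open {x. invertible (g x :: real^'n^'n)}"
proof -
  have "continuous_on UNIV (\<lambda>x. det (g x))"
    by (intro smooth_on_imp_continuous_on smooth_on_det assms open_UNIV)
  then have "open {x. det (g x) \<noteq> 0}"
    by (intro open_Collect_neq continuous_on_const) auto
  then show ?thesis
    by (simp add: invertible_det_nz)
qed

lemma open_invertible: "open {A::real^'n^'n. invertible A}"
  by (rule open_preimage_invertible) (rule smooth_on_entry, simp)

lemma frechet_derivative_eq_0_if_locally_constant:
  assumes "open S" "X \<in> S" "\<And>Y. Y \<in> S \<Longrightarrow> F Y = c"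
  shows "frechet_derivative F (at X) = (\<lambda>v. 0)"
proof -
  have "(F has_derivative (\<lambda>v. 0)) (at X)"
    using has_derivative_transform_within_open[OF has_derivative_const[of c "at X"] assms(1,2), of F] assms(3) by simp
  then show ?thesis
    using frechet_derivative_at by metis
qed

text \<open>Invariance makes \<open>F (U ** X)\<close> constant for \<open>U\<close> near the
  identity; the claim is the vanishing of its derivative at the identity in the direction of the
  elementary matrix at \<open>(p, q)\<close>.\<close>

lemma pderiv_entry_row_invariance:
  assumes "F differentiable (at X)" "\<And>B. invertible B \<Longrightarrow> F (B ** X) = F X"
  shows "(\<Sum>j\<in>UNIV. X $ q $ j * pderiv_entry F p j X) = 0"
proof -
  have "frechet_derivative (\<lambda>U. F (U ** X)) (at (mat 1)) = (\<lambda>v. 0)"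
    by (rule frechet_derivative_eq_0_if_locally_constant[OF open_invertible])
      (auto simp: assms(2) invertible_def)
  then show ?thesis
    using pderiv_entry_matrix_mult_left[of F "mat 1" X p q] assms(1)
    by (simp add: pderiv_entry_def)
qed

text \<open>Evaluates the elimination sums: in the columns \<open>range \<iota>\<close> the entries
  of a cell matrix are Kronecker deltas.\<close>

lemma sum_delta_columns:
  fixes f g h :: "'k::finite \<Rightarrow> real" and y z :: real
  shows "(\<Sum>s\<in>UNIV. f s * (a * (g s * ((if s = p then 1 else 0) * y)) + b * (h s * (z * (if s = q then 1 else 0))))) =
    a * (g p * (f p * y)) + b * (h q * (z * f q))"
proof -
  have "(\<Sum>s\<in>UNIV. f s * (a * (g s * ((if s = p then 1 else 0) * y)) + b * (h s * (z * (if s = q then 1 else 0))))) =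
    (\<Sum>s\<in>UNIV. (if s = p then a * (g s * (f s * y)) else 0) + (if s = q then b * (h s * (z * f s)) else 0))"
    by (intro sum.cong refl) (simp add: algebra_simps)
  then show ?thesis
    by (simp add: sum.distrib)
qed

lemma cell_matrix_entry: "inj \<iota> \<Longrightarrow> cell_matrix \<iota> M $ p $ \<iota> s = (if s = p then 1 else 0)"
  by (auto simp: cell_matrix_def inj_eq)

text \<open>Invariance under \<open>GL\<^sub>k\<close> gives \<open>\<partial>F/\<partial>x\<^bsub>p,\<iota> s\<^esub> = - \<Sum>\<^bsub>k \<notin> I\<^esub> x\<^bsub>sk\<^esub> \<partial>F/\<partial>x\<^bsub>pk\<^esub>\<close> in the cell. This is the
  coefficient that results when these derivatives are eliminated from both arguments.\<close>

lemma mat_coeff_cell_projection: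
  fixes \<iota> :: "'k::{finite,linorder} \<Rightarrow> 'n::{finite,linorder}" and M :: "real^'n::{finite,linorder}^'k::{finite,linorder}" and \<alpha> \<beta> :: real
  assumes "inj \<iota>" "j \<notin> range \<iota>" "k \<notin> range \<iota>"
  defines "X \<equiv> cell_matrix \<iota> M" and "c \<equiv> mat_coeff ((\<beta> - \<alpha>) / 2) ((\<alpha> + \<beta>) / 2)"
  defines "d \<equiv> \<lambda>p j q k. c p j q k X - (\<Sum>s\<in>UNIV. X $ s $ k * c p j q (\<iota> s) X)"
  shows "d p j q k - (\<Sum>r\<in>UNIV. X $ r $ j * d p (\<iota> r) q k) = cell_coeff \<alpha> \<beta> \<iota> p j q k M"
proof -
  define a b where "a = (\<beta> - \<alpha>) / 2" and "b = (\<alpha> + \<beta>) / 2"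
  have X: "X $ p $ \<iota> s = (if s = p then 1 else 0)" for p s
    unfolding X_def by (rule cell_matrix_entry[OF assms(1)])
  \<comment> \<open>Eliminating the second argument cancels the row signs and puts signs of pivot
    columns in their place.\<close>
  have d: "d p j q k = a * ((sign_diff k j - sign_diff (\<iota> p) j) * (X $ p $ k * X $ q $ j)) +
      b * ((sign_diff (\<iota> q) j - sign_diff k j) * (X $ p $ j * X $ q $ k))" for p j q k
    unfolding d_def c_def mat_coeff_def X a_def[symmetric] b_def[symmetric]
    unfolding sum_delta_columns by (simp add: algebra_simps)
  have "(\<Sum>r\<in>UNIV. X $ r $ j * d p (\<iota> r) q k) =
    (\<Sum>r\<in>UNIV. X $ r $ j * (b * ((sign_diff (\<iota> q) (\<iota> r) - sign_diff k (\<iota> r)) * ((if r = p then 1 else 0) * X $ q $ k)) +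
      a * ((sign_diff k (\<iota> r) - sign_diff (\<iota> p) (\<iota> r)) * (X $ p $ k * (if r = q then 1 else 0)))))"
    by (simp only: d X add.commute)
  also have "\<dots> = b * ((sign_diff (\<iota> q) (\<iota> p) - sign_diff k (\<iota> p)) * (X $ p $ j * X $ q $ k)) +
     a * ((sign_diff k (\<iota> q) - sign_diff (\<iota> p) (\<iota> q)) * (X $ p $ k * X $ q $ j))"
    by (rule sum_delta_columns)
  finally have sum: "(\<Sum>r\<in>UNIV. X $ r $ j * d p (\<iota> r) q k) = \<dots>" .
  have XM: "X $ p $ j = M $ p $ j" "X $ p $ k = M $ p $ k" for p
    using assms(2,3) by (auto simp: X_def cell_matrix_def)
  have ne: "\<iota> p \<noteq> j" "\<iota> p \<noteq> k" for p
    using assms(2,3) by auto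
  \<comment> \<open>Each coefficient is now a sum of four signs along a closed walk. The walk in the
    \<open>a\<close> term runs against the orientation of \<open>s_par\<close>, which the sign of
    \<open>(\<beta> - \<alpha>) / 2\<close> corrects.\<close>
  show ?thesis
    unfolding sum unfolding d cell_coeff_def s_cross_eq_s_par s_par_eq[OF ne(1) ne(2) ne(1) ne(2)] a_def b_def XM
    by (simp add: sign_diff_swap[of "\<iota> q" "\<iota> p"] sign_diff_swap[of k j] field_simps)
qed

text \<open>Since the pivot columns form the identity, the hypothesis solves for
  \<open>u (\<iota> q)\<close> in terms of the other \<open>u j\<close>. With \<open>u\<close> a row
  of partial derivatives of an invariant function, this removes one family of derivatives from a
  bracket.\<close>

lemma sum_eliminate_columns:
  fixes \<iota> :: "'k::finite \<Rightarrow> 'n::finite" and u w :: "'n \<Rightarrow> real"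
  assumes "inj \<iota>" "\<And>q. (\<Sum>j\<in>UNIV. cell_matrix \<iota> M $ q $ j * u j) = 0"
  shows "(\<Sum>j\<in>UNIV. u j * w j) = (\<Sum>j\<in>- range \<iota>. u j * (w j - (\<Sum>r\<in>UNIV. cell_matrix \<iota> M $ r $ j * w (\<iota> r))))"
proof -
  let ?X = "cell_matrix \<iota> M"
  have split: "(\<Sum>j\<in>UNIV. h j) = (\<Sum>r\<in>UNIV. h (\<iota> r)) + (\<Sum>j\<in>- range \<iota>. h j)" for h :: "'n \<Rightarrow> real"
  proof -
    have "(\<Sum>j\<in>UNIV. h j) = (\<Sum>j\<in>range \<iota>. h j) + (\<Sum>j\<in>- range \<iota>. h j)"
      by (subst sum.union_disjoint[symmetric]) auto
    then show ?thesis
      by (simp add: sum.reindex[OF assms(1)])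
  qed
  have u: "u (\<iota> q) = - (\<Sum>j\<in>- range \<iota>. ?X $ q $ j * u j)" for q
  proof -
    have "(\<Sum>r\<in>UNIV. ?X $ q $ \<iota> r * u (\<iota> r)) = u (\<iota> q)"
      by (simp add: cell_matrix_entry[OF assms(1)] if_distrib[of "\<lambda>x. x * y" for y] cong: if_cong)
    then show ?thesis
      using assms(2)[of q] unfolding split[of "\<lambda>j. ?X $ q $ j * u j"] by linarith
  qed
  have "(\<Sum>r\<in>UNIV. u (\<iota> r) * w (\<iota> r)) = - (\<Sum>r\<in>UNIV. \<Sum>j\<in>- range \<iota>. ?X $ r $ j * u j * w (\<iota> r))"
    unfolding u by (simp add: sum_distrib_right sum_negf)
  also have "(\<Sum>r\<in>UNIV. \<Sum>j\<in>- range \<iota>. ?X $ r $ j * u j * w (\<iota> r)) =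
      (\<Sum>j\<in>- range \<iota>. u j * (\<Sum>r\<in>UNIV. ?X $ r $ j * w (\<iota> r)))"
    by (subst sum.swap) (simp add: sum_distrib_left mult_ac)
  finally show ?thesis
    unfolding split[of "\<lambda>j. u j * w j"] by (simp add: right_diff_distrib sum_subtractf)
qed

lemma has_derivative_cell_matrix:
  fixes \<iota> :: "'b::finite \<Rightarrow> 'a::finite"
  shows
  "(cell_matrix \<iota> has_derivative (\<lambda>V. \<chi> p j. if j \<in> range \<iota> then 0 else V $ p $ j)) (at M)"
proof -
  have lin: "bounded_linear (\<lambda>V::real^'a^'b. \<chi> p j. if j \<in> range \<iota> then 0 else V $ p $ j)"
    by (subst linear_conv_bounded_linear[symmetric]) (auto intro!: linearI simp: vec_eq_iff)
  have eq: "cell_matrix \<iota> = (\<lambda>V. cell_matrix \<iota> 0 + (\<chi> p j. if j \<in> range \<iota> then 0 else V $ p $ j))"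
    by (auto simp: fun_eq_iff vec_eq_iff cell_matrix_def)
  show ?thesis
    using has_derivative_add[OF has_derivative_const bounded_linear_imp_has_derivative[OF lin]]
    by (subst eq) simp
qed

lemma pderiv_entry_cell_matrix:
  assumes "F differentiable (at (cell_matrix \<iota> M))" "j \<notin> range \<iota>"
  shows "pderiv_entry (F \<circ> cell_matrix \<iota>) p j M = pderiv_entry F p j (cell_matrix \<iota> M)"
proof -
  have "frechet_derivative (F \<circ> cell_matrix \<iota>) (at M) =
    (\<lambda>V. frechet_derivative F (at (cell_matrix \<iota> M)) (\<chi> p j. if j \<in> range \<iota> then 0 else V $ p $ j))"
    unfolding o_def
    by (rule frechet_derivative_at[symmetric], rule has_derivative_compose[OF has_derivative_cell_matrix])
      (use assms(1) in \<open>simp add: frechet_derivative_works\<close>)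
  moreover have "(\<chi> p' j'. if j' \<in> range \<iota> then 0 else axis p (axis j (1::real)) $ p' $ j') = axis p (axis j 1)"
    using assms(2) by (auto simp: vec_eq_iff axis_def)
  ultimately show ?thesis
    by (simp add: pderiv_entry_def)
qed

text \<open>The pivot derivatives are eliminated from \<open>G\<close> first and from
  \<open>F\<close> afterwards; along the remaining columns the derivatives agree with those of the
  restrictions to the cell.\<close>

lemma mat_bracket_cell:
  fixes \<iota> :: "'k::{finite,linorder} \<Rightarrow> 'n::{finite,linorder}"
  assumes "inj \<iota>" "F differentiable (at (cell_matrix \<iota> M))" "G differentiable (at (cell_matrix \<iota> M))"
    and "\<And>B X. invertible B \<Longrightarrow> F (B ** X) = F X" "\<And>B X. invertible B \<Longrightarrow> G (B ** X) = G X"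
  shows "mat_bracket ((\<beta> - \<alpha>) / 2) ((\<alpha> + \<beta>) / 2) F G (cell_matrix \<iota> M) =
    entries_bracket (- range \<iota>) (cell_coeff \<alpha> \<beta> \<iota>) (F \<circ> cell_matrix \<iota>) (G \<circ> cell_matrix \<iota>) M"
proof -
  define X where "X = cell_matrix \<iota> M"
  define u v where "u p j = pderiv_entry F p j X" and "v p j = pderiv_entry G p j X" for p j
  let ?c = "mat_coeff ((\<beta> - \<alpha>) / 2) ((\<alpha> + \<beta>) / 2)"
  let ?d = "\<lambda>p j q k. ?c p j q k X - (\<Sum>s\<in>UNIV. X $ s $ k * ?c p j q (\<iota> s) X)"
  have u0: "(\<Sum>j\<in>UNIV. cell_matrix \<iota> M $ q $ j * u p j) = 0" for p q
    unfolding u_def X_def by (rule pderiv_entry_row_invariance) (fact assms(2), rule assms(4))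
  have v0: "(\<Sum>j\<in>UNIV. cell_matrix \<iota> M $ q $ j * v p j) = 0" for p q
    unfolding v_def X_def by (rule pderiv_entry_row_invariance) (fact assms(3), rule assms(5))
  \<comment> \<open>The bracket of the entry \<open>(p, j)\<close> with \<open>G\<close>: the inner
    sum, which becomes the weight in the second elimination.\<close>
  define Z where "Z p j = (\<Sum>q\<in>UNIV. \<Sum>k\<in>UNIV. v q k * ?c p j q k X)" for p j
  have Z: "Z p j = (\<Sum>q\<in>UNIV. \<Sum>k\<in>- range \<iota>. v q k * ?d p j q k)" for p j
    unfolding Z_def X_def by (intro sum.cong refl sum_eliminate_columns[OF assms(1) v0])
  have "mat_bracket ((\<beta> - \<alpha>) / 2) ((\<alpha> + \<beta>) / 2) F G X = (\<Sum>p\<in>UNIV. \<Sum>j\<in>UNIV. u p j * Z p j)"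
    by (simp add: entries_bracket_def Z_def sum_distrib_left u_def v_def mult_ac)
  also have "\<dots> = (\<Sum>p\<in>UNIV. \<Sum>j\<in>- range \<iota>. u p j * (Z p j - (\<Sum>r\<in>UNIV. X $ r $ j * Z p (\<iota> r))))"
    unfolding X_def by (intro sum.cong refl sum_eliminate_columns[OF assms(1) u0])
  also have "\<dots> = (\<Sum>p\<in>UNIV. \<Sum>j\<in>- range \<iota>. \<Sum>q\<in>UNIV. \<Sum>k\<in>- range \<iota>.
      u p j * v q k * (?d p j q k - (\<Sum>r\<in>UNIV. X $ r $ j * ?d p (\<iota> r) q k)))"
  proof (intro sum.cong refl)
    fix p j
    have "(\<Sum>r\<in>UNIV. X $ r $ j * Z p (\<iota> r)) =
        (\<Sum>q\<in>UNIV. \<Sum>k\<in>- range \<iota>. \<Sum>r\<in>UNIV. X $ r $ j * (v q k * ?d p (\<iota> r) q k))"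
      unfolding Z sum_distrib_left[of "X $ _ $ _"] by (rule sum_rotate3[symmetric])
    also have "\<dots> = (\<Sum>q\<in>UNIV. \<Sum>k\<in>- range \<iota>. v q k * (\<Sum>r\<in>UNIV. X $ r $ j * ?d p (\<iota> r) q k))"
      by (simp only: sum_distrib_left mult.left_commute)
    finally have "Z p j - (\<Sum>r\<in>UNIV. X $ r $ j * Z p (\<iota> r)) =
      (\<Sum>q\<in>UNIV. \<Sum>k\<in>- range \<iota>. v q k * (?d p j q k - (\<Sum>r\<in>UNIV. X $ r $ j * ?d p (\<iota> r) q k)))"
      unfolding Z by (simp only: right_diff_distrib sum_subtractf)
    then show "u p j * (Z p j - (\<Sum>r\<in>UNIV. X $ r $ j * Z p (\<iota> r))) =
      (\<Sum>q\<in>UNIV. \<Sum>k\<in>- range \<iota>. u p j * v q k * (?d p j q k - (\<Sum>r\<in>UNIV. X $ r $ j * ?d p (\<iota> r) q k)))"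
      by (simp only: sum_distrib_left mult.assoc)
  qed
  also have "\<dots> = entries_bracket (- range \<iota>) (cell_coeff \<alpha> \<beta> \<iota>) (F \<circ> cell_matrix \<iota>) (G \<circ> cell_matrix \<iota>) M"
    unfolding entries_bracket_def
  proof (intro sum.cong refl)
    fix p j q k assume "j \<in> - range \<iota>" "k \<in> - range \<iota>"
    then have jk: "j \<notin> range \<iota>" "k \<notin> range \<iota>" by auto
    show "u p j * v q k * (?d p j q k - (\<Sum>r\<in>UNIV. X $ r $ j * ?d p (\<iota> r) q k)) =
      pderiv_entry (F \<circ> cell_matrix \<iota>) p j M * pderiv_entry (G \<circ> cell_matrix \<iota>) q k M * cell_coeff \<alpha> \<beta> \<iota> p j q k M"
      unfolding pderiv_entry_cell_matrix[OF assms(2) jk(1)] pderiv_entry_cell_matrix[OF assms(3) jk(2)] u_def v_def X_def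
        mat_coeff_cell_projection[OF assms(1) jk] ..
  qed
  finally show ?thesis unfolding X_def .
qed

section \<open>Row spans of matrices of full rank\<close>

definition row_span :: "real^'n^'k \<Rightarrow> (real^'n) set" where
  "row_span X = span (rows X)"

text \<open>A right inverse, rather than a rank condition, is the witness from which openness,
  stability under products and local sections are built.\<close>

definition full_rank :: "(real^'n^'k) set" where
  "full_rank = {X. \<exists>Y. X ** Y = mat 1}"

lemma row_span_eq_range: "row_span X = range (\<lambda>x. x v* X)"
proof
  have "linear (\<lambda>x. x v* X)"
    by (simp flip: transpose_matrix_vector)
  then have "subspace (range (\<lambda>x. x v* X))"
    by (simp add: linear_subspace_image)
  moreover have "rows X \<subseteq> range (\<lambda>x. x v* X)"
  proof
    fix r assume "r \<in> rows X"
    then obtain p where "r = row p X" by (auto simp: rows_def)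
    then have "r = axis p 1 v* X"
      by (simp add: row_def vec_eq_iff vector_matrix_mult_def axis_def if_distrib[of "\<lambda>x. x * y" for y] cong: if_cong)
    then show "r \<in> range (\<lambda>x. x v* X)" by blast
  qed
  ultimately show "row_span X \<subseteq> range (\<lambda>x. x v* X)"
    unfolding row_span_def by (rule span_minimal[rotated])
  show "range (\<lambda>x. x v* X) \<subseteq> row_span X"
    using matrix_vector_mult_in_columnspace[of "transpose X"] by (auto simp: row_span_def)
qed

lemma subspace_row_span: "subspace (row_span X)"
  by (simp add: row_span_def)

lemma row_span_mult_subset: "row_span (B ** X) \<subseteq> row_span X"
  by (auto simp: row_span_eq_range simp flip: vector_matrix_mul_assoc)

lemma row_span_invertible_mult:
  assumes "invertible B"
  shows "row_span (B ** X) = row_span X"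
proof
  obtain C where "C ** B = mat 1" using assms by (auto simp: invertible_def)
  then have "X = C ** (B ** X)" by (simp add: matrix_mul_assoc)
  then show "row_span X \<subseteq> row_span (B ** X)" using row_span_mult_subset by metis
qed (rule row_span_mult_subset)

lemma grassmannian_act_row_span: "grassmannian_act (row_span X) A = row_span (X ** A)"
  by (simp add: row_span_eq_range grassmannian_act_def image_image vector_matrix_mul_assoc)

lemma full_rank_iff_dim: "(X::real^'n^'k) \<in> full_rank \<longleftrightarrow> dim (row_span X) = CARD('k)"
  by (simp add: full_rank_def matrix_right_invertible_surjective row_span_def
      flip: full_rank_surjective row_rank_def)

lemma full_rank_matrix_mult:
  assumes "X \<in> full_rank" "invertible A"
  shows "X ** A \<in> full_rank"
proof -
  obtain Y where "X ** Y = mat 1" using assms(1) by (auto simp: full_rank_def)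
  moreover obtain C where "A ** C = mat 1" using assms(2) by (auto simp: invertible_def)
  ultimately have "(X ** A) ** (C ** Y) = mat 1"
    by (metis matrix_mul_assoc matrix_mul_rid)
  then show ?thesis by (auto simp: full_rank_def)
qed

lemma ex_row_span_eq:
  fixes V :: "(real^'n) set"
  assumes "subspace V" "dim V = CARD('k::finite)"
  obtains X :: "real^'n^'k" where "X \<in> full_rank" "row_span X = V"
proof -
  obtain B where B: "B \<subseteq> V" "independent B" "V \<subseteq> span B" "card B = dim V"
    using basis_exists by blast
  then have "finite B" using independent_imp_finite by blast
  then obtain h where h: "bij_betw h (UNIV::'k set) B"
    using B(4) assms(2) by (metis bij_betw_iff_card finite)
  define X :: "real^'n^'k" where "X = (\<chi> p. h p)"
  have "rows X = B"
    using h by (auto simp: rows_def row_def X_def bij_betw_def)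
  then have "row_span X = V"
    using B(1,3) assms(1) by (simp add: row_span_def span_minimal subset_antisym)
  with that[of X] show thesis
    using assms(2) by (simp add: full_rank_iff_dim)
qed

text \<open>Fibres of \<open>row_span\<close> are orbits of the left multiplication. Expressing the
  rows of \<open>X'\<close> by those of \<open>X\<close> gives \<open>B\<close>, and a right inverse
  \<open>Y\<close> of \<open>X'\<close> gives the right inverse \<open>X ** Y\<close> of the square
  matrix \<open>B\<close>.\<close>

lemma row_span_eq_imp:
  fixes X X' :: "real^'n^'k"
  assumes "row_span X' = row_span X" "X' \<in> full_rank"
  obtains B where "invertible B" "X' = B ** X"
proof -
  have "row p X' \<in> row_span X'" for p
    unfolding row_span_def by (rule span_base) (auto simp: rows_def)
  then have "\<exists>x. row p X' = x v* X" for p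
    using assms(1) row_span_eq_range[of X] by auto
  then obtain b where b: "\<And>p. row p X' = b p v* X" by metis
  define B where "B = (\<chi> p. b p)"
  have X': "X' = B ** X"
    using b by (simp add: vec_eq_iff row_def B_def matrix_matrix_mult_def vector_matrix_mult_def mult.commute)
  obtain Y where "X' ** Y = mat 1" using assms(2) by (auto simp: full_rank_def)
  then have "B ** (X ** Y) = mat 1" by (simp add: X' matrix_mul_assoc)
  then have "invertible B" using matrix_left_right_inverse unfolding invertible_def by blast
  with X' show thesis by (rule that[rotated])
qed

section \<open>Pivot columns and normalized representatives\<close>

lemma ex_strict_mono_range:
  fixes I :: "'n::{finite,linorder} set"
  assumes "card I = CARD('k::{finite,linorder})"
  obtains \<iota> :: "'k::{finite,linorder} \<Rightarrow> 'n::{finite,linorder}" where "strict_mono \<iota>" "range \<iota> = I"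
proof -
  \<comment> \<open>The number of predecessors is the zero-based position of \<open>p\<close>, as
    list indexing requires.\<close>
  define \<iota> :: "'k \<Rightarrow> 'n" where "\<iota> p = sorted_list_of_set I ! card {q. q < p}" for p
  have lt: "card {q. q < p} < card I" for p :: 'k
  proof -
    have "{q. q < p} \<subset> UNIV" by auto
    then show ?thesis unfolding assms by (intro psubset_card_mono) auto
  qed
  have "strict_mono \<iota>"
  proof (rule strict_monoI)
    fix p p' :: 'k assume "p < p'"
    then have "card {q. q < p} < card {q. q < p'}"
      by (intro psubset_card_mono) auto
    then show "\<iota> p < \<iota> p'"
      unfolding \<iota>_def using lt[of p'] sorted_wrt_nth_less[OF strict_sorted_list_of_set[of I]] by simp
  qed
  moreover have "range \<iota> = I"
  proof (rule card_subset_eq)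
    have "sorted_list_of_set I ! card {q. q < p} \<in> set (sorted_list_of_set I)" for p :: 'k
      using lt by (intro nth_mem) simp
    then show "range \<iota> \<subseteq> I" by (auto simp: \<iota>_def)
    show "card (range \<iota>) = card I"
      unfolding assms by (intro card_image strict_mono_imp_inj_on) fact
  qed simp
  ultimately show thesis by (rule that)
qed

text \<open>Its determinant is the Pluecker coordinate \<open>x_I\<close>; invertibility singles out
  the cell.\<close>

definition minor_matrix :: "('k::finite \<Rightarrow> 'n::finite) \<Rightarrow> real^'n^'k \<Rightarrow> real^'k^'k" where
  "minor_matrix \<iota> X = (\<chi> p q. X $ p $ \<iota> q)"

text \<open>The cells cover the Grassmannian: a maximal independent set of columns has
  \<open>k\<close> elements, and its indices in increasing order give the pivots.\<close>

lemma full_rank_imp_invertible_minor: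
  fixes X :: "real^'n::{finite,linorder}^'k::{finite,linorder}"
  assumes "X \<in> full_rank"
  obtains \<iota> :: "'k::{finite,linorder} \<Rightarrow> 'n::{finite,linorder}" where "strict_mono \<iota>" "invertible (minor_matrix \<iota> X)"
proof -
  have cols: "span (columns X) = UNIV"
    using assms by (simp add: full_rank_def matrix_right_invertible_span_columns span_vec_eq)
  obtain C where C: "C \<subseteq> columns X" "independent C" "columns X \<subseteq> span C"
    using maximal_independent_subset by blast
  have sC: "span C = UNIV"
    using C(3) cols span_mono span_span by (metis UNIV_eq_I UNIV_I subsetD)
  then have card: "card C = CARD('k)"
    using C(2) by (metis dim_UNIV dim_span_eq_card_independent DIM_cart DIM_real mult.right_neutral)
  \<comment> \<open>Equal columns may sit at several positions; one index is chosen for each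
    column.\<close>
  define g where "g c = (SOME j. column j X = c)" for c
  have g: "column (g c) X = c" if "c \<in> C" for c
    using C(1) that unfolding g_def columns_def by (intro someI_ex[of "\<lambda>j. column j X = c"]) auto
  then have "inj_on g C" by (metis inj_onI)
  then have "card (g ` C) = CARD('k)" by (simp add: card card_image)
  then obtain \<iota> :: "'k \<Rightarrow> 'n" where \<iota>: "strict_mono \<iota>" "range \<iota> = g ` C"
    by (rule ex_strict_mono_range)
  have "columns (minor_matrix \<iota> X) = (\<lambda>j. column j X) ` range \<iota>"
    by (auto simp: columns_def column_def minor_matrix_def)
  also have "\<dots> = C"
    unfolding \<iota>(2) using g by force
  finally have "\<exists>B. minor_matrix \<iota> X ** B = mat 1"
    using sC by (simp add: matrix_right_invertible_span_columns span_vec_eq)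
  then have "invertible (minor_matrix \<iota> X)"
    using matrix_left_right_inverse unfolding invertible_def by blast
  with \<iota>(1) show thesis by (rule that)
qed

lemma matrix_inv_cancel:
  assumes "invertible (A::real^'n^'n)"
  shows "A ** matrix_inv A = mat 1" "matrix_inv A ** A = mat 1"
  using someI_ex[OF assms[unfolded invertible_def]] by (simp_all add: matrix_inv_def)

lemma invertible_matrix_inv: "invertible (A::real^'n^'n) \<Longrightarrow> invertible (matrix_inv A)"
  using matrix_inv_cancel unfolding invertible_def by blast

lemma minor_matrix_mult: "minor_matrix \<iota> (B ** X) = B ** minor_matrix \<iota> X"
  by (simp add: minor_matrix_def matrix_matrix_mult_def vec_eq_iff)

lemma cell_matrix_normalize:
  assumes "inj \<iota>" "invertible (minor_matrix \<iota> X)"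
  shows "cell_matrix \<iota> (matrix_inv (minor_matrix \<iota> X) ** X) = matrix_inv (minor_matrix \<iota> X) ** X"
proof -
  let ?Z = "matrix_inv (minor_matrix \<iota> X) ** X"
  have "minor_matrix \<iota> ?Z = mat 1"
    by (simp add: minor_matrix_mult matrix_inv_cancel(2)[OF assms(2)])
  then have "?Z $ p $ \<iota> q = (if p = q then 1 else 0)" for p q
    by (simp add: minor_matrix_def mat_def vec_eq_iff)
  then show ?thesis
    using assms(1) by (auto simp: vec_eq_iff cell_matrix_def inj_eq)
qed

lemma cell_param_eq: "cell_param \<iota> M = row_span (cell_matrix \<iota> M)"
  by (simp add: cell_param_def row_span_def)

lemma row_span_eq_cell_param:
  assumes "inj \<iota>" "invertible (minor_matrix \<iota> X)"
  shows "row_span X = cell_param \<iota> (matrix_inv (minor_matrix \<iota> X) ** X)"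
  by (simp add: cell_param_eq cell_matrix_normalize[OF assms]
      row_span_invertible_mult[OF invertible_matrix_inv[OF assms(2)]])

lemma cell_matrix_full_rank:
  assumes "inj \<iota>"
  shows "cell_matrix \<iota> M \<in> full_rank"
proof -
  \<comment> \<open>The right inverse selects the pivot columns.\<close>
  have "cell_matrix \<iota> M ** (\<chi> j q. if j = \<iota> q then 1 else 0) = mat 1"
    using cell_matrix_entry[OF assms, of M]
    by (auto simp: vec_eq_iff matrix_matrix_mult_def mat_def if_distrib[of "\<lambda>x. y * x" for y] cong: if_cong)
  then show ?thesis by (auto simp: full_rank_def)
qed

section \<open>Smooth functions on the Grassmannian and on the general linear group\<close>

lemma smooth_on_matrix_mult:
  fixes A :: "'d::real_normed_vector \<Rightarrow> real^'m^'r" and B :: "'d \<Rightarrow> real^'c^'m"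
  assumes "open S" "\<And>i j. smooth_on S (\<lambda>x. A x $ i $ j)" "\<And>i j. smooth_on S (\<lambda>x. B x $ i $ j)"
  shows "smooth_on S (\<lambda>x. (A x ** B x) $ i $ j)"
  by (simp add: matrix_matrix_mult_def, intro smooth_on_sum smooth_on_mult assms)

text \<open>Cramer's rule for the columns of the inverse; it shows that the entries are rational,
  hence smooth, functions of \<open>A\<close>.\<close>

lemma matrix_inv_entry:
  fixes A :: "real^'n^'n"
  assumes "invertible A"
  shows "matrix_inv A $ i $ j = det (\<chi> k l. if l = i then axis j 1 $ k else A $ k $ l) * inverse (det A)"
proof -
  have "A *v column j (matrix_inv A) = axis j 1"
    using matrix_inv_cancel(1)[OF assms]
    by (metis matrix_vector_mul_assoc matrix_vector_mult_basis matrix_vector_mul_lid)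
  then have "column j (matrix_inv A) = (\<chi> i. det (\<chi> k l. if l = i then axis j 1 $ k else A $ k $ l) / det A)"
    using assms by (simp add: cramer invertible_det_nz)
  then show ?thesis
    by (simp add: column_def vec_eq_iff divide_inverse)
qed

lemma smooth_on_matrix_inv:
  fixes g :: "'d::real_normed_vector \<Rightarrow> real^'n^'n"
  assumes "open S" "\<And>i j. smooth_on S (\<lambda>x. g x $ i $ j)" "\<And>x. x \<in> S \<Longrightarrow> invertible (g x)"
  shows "smooth_on S (\<lambda>x. matrix_inv (g x) $ i $ j)"
proof -
  have "smooth_on S (\<lambda>x. (\<chi> k l. if l = i then axis j 1 $ k else g x $ k $ l) $ k $ l)" for k l
    using assms(2) smooth_on_const[OF assms(1)] by (cases "l = i") auto
  then have "smooth_on S (\<lambda>x. det (\<chi> k l. if l = i then axis j 1 $ k else g x $ k $ l) * inverse (det (g x)))"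
    using assms by (intro smooth_on_mult smooth_on_inverse smooth_on_det) (auto simp: invertible_det_nz)
  moreover have "matrix_inv (g x) $ i $ j = det (\<chi> k l. if l = i then axis j 1 $ k else g x $ k $ l) * inverse (det (g x))"
    if "x \<in> S" for x
    by (rule matrix_inv_entry[OF assms(3)[OF that]])
  ultimately show ?thesis
    using smooth_on_cong[OF assms(1), of "\<lambda>x. matrix_inv (g x) $ i $ j"] by simp
qed

lemma smooth_on_minor_matrix: "open S \<Longrightarrow> smooth_on S (\<lambda>X. minor_matrix \<iota> X $ p $ q)"
  by (simp add: minor_matrix_def smooth_on_entry)

lemma smooth_on_matrix_mult_left: "open S \<Longrightarrow> smooth_on S (\<lambda>Z. (Z ** Y) $ i $ j)"
  by (intro smooth_on_matrix_mult smooth_on_const smooth_on_entry)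

lemma smooth_on_matrix_mult_right: "open S \<Longrightarrow> smooth_on S (\<lambda>A. (X ** A) $ i $ j)"
  by (intro smooth_on_matrix_mult smooth_on_const smooth_on_entry)

text \<open>A right inverse \<open>Y\<close> of \<open>X\<close> gives the neighbourhood where
  \<open>Z ** Y\<close> is invertible; there \<open>Z\<close> has a right inverse too.\<close>

lemma open_full_rank: "open (full_rank :: (real^'n^'k) set)"
proof (subst open_subopen, safe)
  fix X :: "real^'n^'k" assume "X \<in> full_rank"
  then obtain Y where Y: "X ** Y = mat 1" by (auto simp: full_rank_def)
  let ?T = "{Z::real^'n^'k. invertible (Z ** Y)}"
  have "open ?T"
  proof (rule open_preimage_invertible)
    show "smooth_on UNIV (\<lambda>Z. (Z ** Y) $ i $ j)" for i j
      by (rule smooth_on_matrix_mult_left) simp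
  qed
  moreover have "X \<in> ?T"
    using Y by (auto simp: invertible_def intro: exI[of _ "mat 1"])
  moreover have "?T \<subseteq> full_rank"
    by (auto simp: full_rank_def invertible_def) (metis matrix_mul_assoc)
  ultimately show "\<exists>T. open T \<and> X \<in> T \<and> T \<subseteq> full_rank" by blast
qed

lemma smooth_on_cell_matrix: "open S \<Longrightarrow> smooth_on S (\<lambda>M. cell_matrix \<iota> M $ p $ j)"
  by (cases "j \<in> range \<iota>") (simp_all add: cell_matrix_def smooth_on_const smooth_on_entry)

text \<open>The bridge from cells to matrices. Near a full-rank matrix, multiplication by the
  inverse of an invertible minor is a smooth passage to cell coordinates; conversely
  \<open>cell_matrix\<close> is a smooth map into the full-rank matrices.\<close>

lemma smooth_fun_grassmannian_iff:
  "smooth_fun (grassmannian :: (real^'n::{finite,linorder}^'k::{finite,linorder}, _) space) f \<longleftrightarrow>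
    smooth_on (full_rank :: (real^'n::{finite,linorder}^'k::{finite,linorder}) set) (\<lambda>X. f (row_span X))"
proof
  assume f: "smooth_fun (grassmannian :: (real^'n::{finite,linorder}^'k::{finite,linorder}, _) space) f"
  show "smooth_on (full_rank :: (real^'n::{finite,linorder}^'k::{finite,linorder}) set) (\<lambda>X. f (row_span X))"
  proof (rule smooth_on_local[OF open_full_rank])
    fix X :: "real^'n::{finite,linorder}^'k::{finite,linorder}" assume "X \<in> full_rank"
    then obtain \<iota> :: "'k \<Rightarrow> 'n" where \<iota>: "strict_mono \<iota>" "invertible (minor_matrix \<iota> X)"
      by (rule full_rank_imp_invertible_minor)
    have inj: "inj \<iota>" using \<iota>(1) by (rule strict_mono_imp_inj_on)
    let ?T = "{Z. invertible (minor_matrix \<iota> Z)}"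
    have T: "open ?T" by (intro open_preimage_invertible smooth_on_minor_matrix) simp
    have fc: "smooth_on UNIV (f \<circ> cell_param \<iota>)"
      using f \<iota>(1) by (auto simp: smooth_fun_def grassmannian_def)
    have sm: "smooth_on ?T (\<lambda>Z. (f \<circ> cell_param \<iota>) (matrix_inv (minor_matrix \<iota> Z) ** Z))"
    proof (rule smooth_on_compose_matrix[OF T open_UNIV])
      show "smooth_on ?T (\<lambda>Z. (matrix_inv (minor_matrix \<iota> Z) ** Z) $ p $ j)" for p j
        by (intro smooth_on_matrix_mult smooth_on_matrix_inv smooth_on_entry smooth_on_minor_matrix T) simp
    qed (simp, rule fc)
    have eq: "f (row_span Z) = (f \<circ> cell_param \<iota>) (matrix_inv (minor_matrix \<iota> Z) ** Z)" if "Z \<in> ?T" for Z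
      using row_span_eq_cell_param[OF inj, of Z] that by simp
    have "smooth_on ?T (\<lambda>Z. f (row_span Z))"
      by (rule iffD2[OF smooth_on_cong[OF T eq] sm])
    then show "\<exists>T. open T \<and> X \<in> T \<and> smooth_on T (\<lambda>Z. f (row_span Z))"
      using T \<iota>(2) by blast
  qed
next
  assume f: "smooth_on (full_rank :: (real^'n::{finite,linorder}^'k::{finite,linorder}) set) (\<lambda>X. f (row_span X))"
  have "smooth_on UNIV (f \<circ> cell_param \<iota>)" if "strict_mono \<iota>" for \<iota> :: "'k \<Rightarrow> 'n"
    unfolding o_def cell_param_eq
    using cell_matrix_full_rank[OF strict_mono_imp_inj_on[OF that]]
    by (intro smooth_on_compose_matrix[OF open_UNIV open_full_rank _ f] smooth_on_cell_matrix) auto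
  then show "smooth_fun (grassmannian :: (real^'n::{finite,linorder}^'k::{finite,linorder}, _) space) f"
    by (auto simp: smooth_fun_def grassmannian_def)
qed

lemma smooth_fun_GL_iff: "smooth_fun GL_space f \<longleftrightarrow> smooth_on {A. invertible A} f"
  by (simp add: smooth_fun_def GL_space_def o_def)

section \<open>The Poisson--Lie group\<close>

lemma GL_bracket_eq:
  "(GL_bracket \<beta> \<alpha> :: (real^'n::{finite,linorder}^'n::{finite,linorder}) bracket) =
    mat_bracket ((\<beta> - \<alpha>) / 2) ((\<alpha> + \<beta>) / 2)"
proof -
  have "(GL_coeff \<beta> \<alpha> :: 'n::{finite,linorder} \<Rightarrow> _) = mat_coeff ((\<beta> - \<alpha>) / 2) ((\<alpha> + \<beta>) / 2)"
    by (intro ext) (simp add: GL_coeff_def mat_coeff_def field_simps)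
  then show ?thesis by (simp add: GL_bracket_def)
qed

lemma smooth_on_imp_differentiable: "smooth_on S f \<Longrightarrow> x \<in> S \<Longrightarrow> f differentiable (at x)"
  using smooth_on_has_derivative differentiableI by blast

lemma group_GL: "group (GL_group :: (real^'n^'n) monoid)"
proof (rule groupI)
  fix A :: "real^'n^'n" assume "A \<in> carrier GL_group"
  then have "invertible A" by (simp add: GL_group_def)
  then show "\<exists>B\<in>carrier GL_group. B \<otimes>\<^bsub>GL_group\<^esub> A = \<one>\<^bsub>GL_group\<^esub>"
    by (intro bexI[of _ "matrix_inv A"]) (auto simp: GL_group_def matrix_inv_cancel invertible_matrix_inv)
qed (auto simp: GL_group_def invertible_mult matrix_mul_assoc, auto simp: invertible_def)

lemma carrier_GL: "A \<in> carrier GL_group \<longleftrightarrow> invertible A"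
  by (simp add: GL_group_def)

lemma GL_inv: "invertible A \<Longrightarrow> inv\<^bsub>GL_group\<^esub> A = matrix_inv A"
  by (rule group.inv_equality[OF group_GL])
    (auto simp: GL_group_def matrix_inv_cancel invertible_matrix_inv)

lemma GL_mult: "A \<otimes>\<^bsub>GL_group\<^esub> B = A ** B"
  by (simp add: GL_group_def)

lemma smooth_on_fst_entry: "open S \<Longrightarrow> smooth_on S (\<lambda>x. fst x $ i $ j)"
  by (rule smooth_on_bounded_linear[OF _ bounded_linear_compose[OF bounded_linear_entry bounded_linear_fst]])

lemma smooth_on_snd_entry: "open S \<Longrightarrow> smooth_on S (\<lambda>x. snd x $ i $ j)"
  by (rule smooth_on_bounded_linear[OF _ bounded_linear_compose[OF bounded_linear_entry bounded_linear_snd]])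

lemma smooth_map_GL_mult:
  "smooth_map (prod_space GL_space GL_space) GL_space (\<lambda>(A, B). A \<otimes>\<^bsub>GL_group\<^esub> (B :: real^'n^'n))"
proof -
  let ?S = "{A::real^'n^'n. invertible A} \<times> {A::real^'n^'n. invertible A}"
  have S: "open ?S" by (intro open_Times open_invertible)
  have "smooth_on ?S (\<lambda>x. f (fst x ** snd x))" if "smooth_on {A. invertible A} f" for f
    using S that
    by (intro smooth_on_compose_matrix[OF S open_invertible _ that] smooth_on_matrix_mult smooth_on_fst_entry smooth_on_snd_entry)
      (auto simp: invertible_mult)
  then show ?thesis
    by (auto simp: smooth_map_def smooth_fun_def prod_space_def GL_space_def GL_mult invertible_mult o_def
        case_prod_beta map_prod_def)
qed

lemma smooth_map_GL_inv: "smooth_map GL_space GL_space (\<lambda>A::real^'n^'n. inv\<^bsub>GL_group\<^esub> A)"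
proof -
  have "smooth_on {A::real^'n^'n. invertible A} (\<lambda>A. f (inv\<^bsub>GL_group\<^esub> A))"
    if "smooth_on {A::real^'n^'n. invertible A} f" for f
  proof -
    have sm: "smooth_on {A::real^'n^'n. invertible A} (\<lambda>A. f (matrix_inv A))"
      by (intro smooth_on_compose_matrix[OF open_invertible open_invertible _ that] smooth_on_matrix_inv
          smooth_on_entry open_invertible) (auto simp: invertible_matrix_inv)
    have eq: "f (inv\<^bsub>GL_group\<^esub> A) = f (matrix_inv A)" if "A \<in> {A. invertible A}" for A
      using that by (simp add: GL_inv)
    show ?thesis
      by (rule iffD2[OF smooth_on_cong[OF open_invertible eq] sm])
  qed
  then show ?thesis
    by (auto simp: smooth_map_def smooth_fun_GL_iff o_def) (auto simp: GL_space_def GL_inv invertible_matrix_inv)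
qed

lemma poisson_bracket_GL:
  "poisson_bracket GL_space (mat_bracket a b :: (real^'n::{finite,linorder}^'n::{finite,linorder}) bracket)"
  unfolding poisson_bracket_def smooth_fun_GL_iff
proof (intro conjI allI impI ballI)
  let ?S = "{A :: real^'n::{finite,linorder}^'n::{finite,linorder}. invertible A}"
  fix f g h :: "real^'n::{finite,linorder}^'n::{finite,linorder} \<Rightarrow> real" 
    and c :: real and x :: "real^'n::{finite,linorder}^'n::{finite,linorder}"
  assume f: "smooth_on ?S f" and g: "smooth_on ?S g"
  show "smooth_on ?S (mat_bracket a b f g)"
    by (rule mat_bracket_smooth[OF open_invertible f g])
  assume "x \<in> pts GL_space"
  then have x: "x \<in> ?S" by (simp add: GL_space_def)
  show "mat_bracket a b f h x = mat_bracket a b g h x" if "\<forall>x\<in>pts GL_space. f x = g x"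
    using that by (intro entries_bracket_cong[OF open_invertible x]) (auto simp: GL_space_def)
  show "mat_bracket a b f g x = - mat_bracket a b g f x"
    by (rule mat_bracket_antisymmetric)
  show "mat_bracket a b (\<lambda>u. f u + g u) h x = mat_bracket a b f h x + mat_bracket a b g h x"
    by (rule mat_bracket_add[OF x f g])
  show "mat_bracket a b (\<lambda>u. c * f u) h x = c * mat_bracket a b f h x"
    by (rule mat_bracket_cmult[OF x f])
  show "mat_bracket a b (\<lambda>u. f u * g u) h x = f x * mat_bracket a b g h x + mat_bracket a b f h x * g x"
    by (rule mat_bracket_mult[OF x f g])
  assume h: "smooth_on ?S h"
  show "mat_bracket a b f (mat_bracket a b g h) x + mat_bracket a b g (mat_bracket a b h f) x +
      mat_bracket a b h (mat_bracket a b f g) x = 0"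
    by (rule mat_bracket_jacobi[OF open_invertible x f g h])
qed

lemma poisson_lie_group_GL:
  "poisson_lie_group GL_space GL_group (mat_bracket a b :: (real^'n::{finite,linorder}^'n::{finite,linorder}) bracket)"
proof -
  have "prod_bracket (mat_bracket a b) (mat_bracket a b) (f \<circ> (\<lambda>(A, B). A \<otimes>\<^bsub>GL_group\<^esub> B))
      (g \<circ> (\<lambda>(A, B). A \<otimes>\<^bsub>GL_group\<^esub> B)) (A, B) = mat_bracket a b f g (A ** B)"
    if "smooth_on {A. invertible A} f" "smooth_on {A. invertible A} g" "invertible A" "invertible B"
    for f g and A B :: "real^'n::{finite,linorder}^'n::{finite,linorder}"
    using mat_bracket_matrix_mult[of f A B g] that
    by (simp add: prod_bracket_def GL_mult smooth_on_imp_differentiable invertible_mult)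
  moreover have "pts (prod_space GL_space GL_space) =
    {A::real^'n::{finite,linorder}^'n::{finite,linorder}. invertible A} \<times>
     {A::real^'n::{finite,linorder}^'n::{finite,linorder}. invertible A}"
    by (simp add: prod_space_def GL_space_def)
  ultimately have "poisson_map (prod_space GL_space GL_space) (prod_bracket (mat_bracket a b) (mat_bracket a b)) GL_space
    (mat_bracket a b) (\<lambda>(A, B). A \<otimes>\<^bsub>GL_group\<^esub> (B::real^'n::{finite,linorder}^'n::{finite,linorder}))"
    using smooth_map_GL_mult by (auto simp: poisson_map_def smooth_fun_GL_iff GL_mult)
  moreover have "carrier GL_group = pts (GL_space :: (real^'n::{finite,linorder}^'n::{finite,linorder}, _) space)"
    by (simp add: GL_group_def GL_space_def)
  ultimately show ?thesis
    unfolding poisson_lie_group_def lie_group_def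
    using group_GL smooth_map_GL_mult smooth_map_GL_inv poisson_bracket_GL by blast
qed

section \<open>The descended bracket\<close>

text \<open>The product of \<open>B\<close> and \<open>X\<close> is Poisson. As functions of
  \<open>B\<close> the two pullbacks are locally constant and contribute nothing; as functions of
  \<open>X\<close> they are \<open>F\<close> and \<open>G\<close> again.\<close>

lemma mat_bracket_invariant:
  fixes X :: "real^'n::{finite,linorder}^'k::{finite,linorder}"
  assumes "F differentiable (at (B ** X))" "G differentiable (at (B ** X))" "invertible B"
    and F: "\<And>B X. invertible B \<Longrightarrow> F (B ** X) = F X" and G: "\<And>B X. invertible B \<Longrightarrow> G (B ** X) = G X"
  shows "mat_bracket a b F G (B ** X) = mat_bracket a b F G X"
proof -
  have "frechet_derivative (\<lambda>U. F (U ** X)) (at B) = (\<lambda>v. 0)"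
    by (rule frechet_derivative_eq_0_if_locally_constant[OF open_invertible]) (auto simp: assms)
  then have "mat_bracket a b (\<lambda>U. F (U ** X)) (\<lambda>U. G (U ** X)) B = 0"
    by (simp add: entries_bracket_def pderiv_entry_def)
  then show ?thesis
    by (simp add: mat_bracket_matrix_mult[OF assms(1,2)] F[OF assms(3)] G[OF assms(3)])
qed

lemma mat_bracket_row_span_cong:
  fixes X X' :: "real^'n::{finite,linorder}^'k::{finite,linorder}"
  assumes f: "smooth_fun (grassmannian :: (real^'n::{finite,linorder}^'k::{finite,linorder}, _) space) f"
    and g: "smooth_fun (grassmannian :: (real^'n::{finite,linorder}^'k::{finite,linorder}, _) space) g"
    and X: "X \<in> full_rank" "X' \<in> full_rank" "row_span X' = row_span X"
  shows "mat_bracket a b (\<lambda>X. f (row_span X)) (\<lambda>X. g (row_span X)) X' =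
    mat_bracket a b (\<lambda>X. f (row_span X)) (\<lambda>X. g (row_span X)) X"
proof -
  obtain B where B: "invertible B" "X' = B ** X"
    using X(3,2) by (rule row_span_eq_imp)
  show ?thesis
    using X(2) f g unfolding B(2) smooth_fun_grassmannian_iff
    by (intro mat_bracket_invariant smooth_on_imp_differentiable[where S = full_rank] B(1))
      (auto simp: row_span_invertible_mult)
qed

text \<open>For smooth \<open>f\<close> and \<open>g\<close> the chosen representative does not
  matter, by \<open>mat_bracket_row_span_cong\<close>.\<close>

definition descended_bracket ::
  "real \<Rightarrow> real \<Rightarrow> 'k::{finite,linorder} itself \<Rightarrow> (real^'n::{finite,linorder}) set bracket" where
  "descended_bracket a b _ f g V = mat_bracket a b (\<lambda>X. f (row_span X)) (\<lambda>X. g (row_span X))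
     (SOME X :: real^'n::{finite,linorder}^'k::{finite,linorder}. X \<in> full_rank \<and> row_span X = V)"

lemma descended_bracket_row_span:
  fixes X :: "real^'n::{finite,linorder}^'k::{finite,linorder}"
  assumes f: "smooth_fun (grassmannian :: (real^'n::{finite,linorder}^'k::{finite,linorder}, _) space) f"
    and g: "smooth_fun (grassmannian :: (real^'n::{finite,linorder}^'k::{finite,linorder}, _) space) g"
    and X: "X \<in> full_rank"
  shows "descended_bracket a b TYPE('k) f g (row_span X) =
    mat_bracket a b (\<lambda>X. f (row_span X)) (\<lambda>X. g (row_span X)) X"
proof -
  let ?X = "SOME X' :: real^'n::{finite,linorder}^'k::{finite,linorder}. X' \<in> full_rank \<and> row_span X' = row_span X"
  have "?X \<in> full_rank \<and> row_span ?X = row_span X"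
    by (rule someI[of _ X]) (simp add: X)
  then show ?thesis
    unfolding descended_bracket_def by (intro mat_bracket_row_span_cong[OF f g X]) auto
qed

lemma pts_grassmannian:
  "V \<in> pts (grassmannian :: (real^'n::{finite,linorder}^'k::{finite,linorder}, _) space) \<longleftrightarrow>
    subspace V \<and> dim V = CARD('k)"
  by (simp add: grassmannian_def)

lemma row_span_in_grassmannian:
  fixes X :: "real^'n::{finite,linorder}^'k::{finite,linorder}"
  shows "X \<in> full_rank \<Longrightarrow>
    row_span X \<in> pts (grassmannian :: (real^'n::{finite,linorder}^'k::{finite,linorder}, _) space)"
  by (simp add: pts_grassmannian subspace_row_span full_rank_iff_dim)

lemma grassmannian_cases:
  assumes "V \<in> pts (grassmannian :: (real^'n::{finite,linorder}^'k::{finite,linorder}, _) space)"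
  obtains X :: "real^'n::{finite,linorder}^'k::{finite,linorder}" where "X \<in> full_rank" "V = row_span X"
  using assms ex_row_span_eq[of V] unfolding pts_grassmannian by metis

lemma poisson_bracket_descended:
  "poisson_bracket (grassmannian :: (real^'n::{finite,linorder}^'k::{finite,linorder}, _) space)
    (descended_bracket a b TYPE('k))"
  unfolding poisson_bracket_def
proof (intro conjI allI impI ballI)
  let ?S = "full_rank :: (real^'n::{finite,linorder}^'k::{finite,linorder}) set"
  let ?Gr = "grassmannian :: (real^'n::{finite,linorder}^'k::{finite,linorder}, _) space"
  let ?D = "descended_bracket a b TYPE('k)"
  let ?m = "mat_bracket a b :: (real^'n::{finite,linorder}^'k::{finite,linorder}) bracket"
  have lift: "smooth_fun ?Gr f \<Longrightarrow> smooth_on ?S (\<lambda>X. f (row_span X))" for f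
    by (simp add: smooth_fun_grassmannian_iff)
  have closed: "smooth_fun ?Gr (?D f g)" if "smooth_fun ?Gr f" "smooth_fun ?Gr g" for f g
    unfolding smooth_fun_grassmannian_iff
    by (rule iffD2[OF smooth_on_cong[OF open_full_rank descended_bracket_row_span[OF that]]
        mat_bracket_smooth[OF open_full_rank lift[OF that(1)] lift[OF that(2)]]])
  fix f g h :: "(real^'n::{finite,linorder}) set \<Rightarrow> real" and c :: real and V :: "(real^'n::{finite,linorder}) set"
  assume f: "smooth_fun ?Gr f" and g: "smooth_fun ?Gr g"
  show "smooth_fun ?Gr (?D f g)" using f g by (rule closed)
  assume h: "smooth_fun ?Gr h" and V: "V \<in> pts ?Gr"
  obtain X :: "real^'n::{finite,linorder}^'k::{finite,linorder}" where X: "X \<in> ?S" and VX: "V = row_span X"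
    using V by (rule grassmannian_cases)
  note D = descended_bracket_row_span[OF _ _ X]
  show "?D f h V = ?D g h V" if "\<forall>V\<in>pts ?Gr. f V = g V"
    unfolding VX D[OF f h] D[OF g h]
    by (rule entries_bracket_cong[OF open_full_rank X]) (use that row_span_in_grassmannian in blast)+
  show "?D f g V = - ?D g f V"
    unfolding VX D[OF f g] D[OF g f] by (rule mat_bracket_antisymmetric)
  have fg: "smooth_fun ?Gr (\<lambda>u. f u + g u)"
    unfolding smooth_fun_grassmannian_iff by (intro smooth_on_add open_full_rank lift f g)
  show "?D (\<lambda>u. f u + g u) h V = ?D f h V + ?D g h V"
    unfolding VX D[OF fg h] D[OF f h] D[OF g h] by (rule mat_bracket_add[OF X lift[OF f] lift[OF g]])
  have cf: "smooth_fun ?Gr (\<lambda>u. c * f u)"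
    unfolding smooth_fun_grassmannian_iff by (intro smooth_on_mult smooth_on_const open_full_rank lift f)
  show "?D (\<lambda>u. c * f u) h V = c * ?D f h V"
    unfolding VX D[OF cf h] D[OF f h] by (rule mat_bracket_cmult[OF X lift[OF f]])
  have mfg: "smooth_fun ?Gr (\<lambda>u. f u * g u)"
    unfolding smooth_fun_grassmannian_iff by (intro smooth_on_mult open_full_rank lift f g)
  show "?D (\<lambda>u. f u * g u) h V = f V * ?D g h V + ?D f h V * g V"
    unfolding VX D[OF mfg h] D[OF f h] D[OF g h] by (rule mat_bracket_mult[OF X lift[OF f] lift[OF g]])
  \<comment> \<open>The inner bracket is known only on full-rank matrices; this set is open, so the
    outer derivatives do not see other values.\<close>
  have nested: "?D f (?D g h) V = ?m (\<lambda>X. f (row_span X)) (?m (\<lambda>X. g (row_span X)) (\<lambda>X. h (row_span X))) X"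
    if f: "smooth_fun ?Gr f" and g: "smooth_fun ?Gr g" and h: "smooth_fun ?Gr h" for f g h
    unfolding VX D[OF f closed[OF g h]]
    by (rule entries_bracket_cong[OF open_full_rank X refl descended_bracket_row_span[OF g h]])
  show "?D f (?D g h) V + ?D g (?D h f) V + ?D h (?D f g) V = 0"
    unfolding nested[OF f g h] nested[OF g h f] nested[OF h f g]
    by (rule mat_bracket_jacobi[OF open_full_rank X lift[OF f] lift[OF g] lift[OF h]])
qed

lemma mat_bracket_cell_param:
  fixes \<iota> :: "'k::{finite,linorder} \<Rightarrow> 'n::{finite,linorder}"
  assumes \<iota>: "strict_mono \<iota>"
    and f: "smooth_fun (grassmannian :: (real^'n::{finite,linorder}^'k::{finite,linorder}, _) space) f"
    and g: "smooth_fun (grassmannian :: (real^'n::{finite,linorder}^'k::{finite,linorder}, _) space) g"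
  shows "mat_bracket ((\<beta> - \<alpha>) / 2) ((\<alpha> + \<beta>) / 2) (\<lambda>X. f (row_span X)) (\<lambda>X. g (row_span X)) (cell_matrix \<iota> M) =
    entries_bracket (- range \<iota>) (cell_coeff \<alpha> \<beta> \<iota>) (f \<circ> cell_param \<iota>) (g \<circ> cell_param \<iota>) M"
proof -
  have inj: "inj \<iota>" using \<iota> by (rule strict_mono_imp_inj_on)
  have "h \<circ> cell_param \<iota> = (\<lambda>X. h (row_span X)) \<circ> cell_matrix \<iota>" for h :: "(real^'n::{finite,linorder}) set \<Rightarrow> real"
    by (simp add: fun_eq_iff cell_param_eq)
  then show ?thesis
    using f g cell_matrix_full_rank[OF inj, of M] unfolding smooth_fun_grassmannian_iff
    by (simp only:) (intro mat_bracket_cell inj; auto intro: smooth_on_imp_differentiable simp: row_span_invertible_mult)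
qed

lemma grassmannian_bracket_descended:
  "grassmannian_bracket \<alpha> \<beta> TYPE('k::{finite,linorder})
    (descended_bracket ((\<beta> - \<alpha>) / 2) ((\<alpha> + \<beta>) / 2) TYPE('k) :: (real^'n::{finite,linorder}) set bracket)"
  unfolding grassmannian_bracket_def
proof (intro conjI allI impI poisson_bracket_descended)
  fix \<iota> :: "'k \<Rightarrow> 'n" and f g M
  assume \<iota>: "strict_mono \<iota>"
    and f: "smooth_fun (grassmannian :: (real^'n::{finite,linorder}^'k::{finite,linorder}, _) space) f"
    and g: "smooth_fun (grassmannian :: (real^'n::{finite,linorder}^'k::{finite,linorder}, _) space) g"
  show "descended_bracket ((\<beta> - \<alpha>) / 2) ((\<alpha> + \<beta>) / 2) TYPE('k) f g (cell_param \<iota> M) =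
    entries_bracket (- range \<iota>) (cell_coeff \<alpha> \<beta> \<iota>) (f \<circ> cell_param \<iota>) (g \<circ> cell_param \<iota>) M"
    unfolding mat_bracket_cell_param[OF \<iota> f g, symmetric] cell_param_eq
    by (rule descended_bracket_row_span[OF f g cell_matrix_full_rank[OF strict_mono_imp_inj_on[OF \<iota>]]])
qed

text \<open>Uniqueness: every full-rank matrix has the row span of a cell matrix, so the cell
  formula alone determines \<open>P\<close> on smooth functions. Statements about an arbitrary
  \<open>P\<close> thereby become statements about matrices.\<close>

lemma grassmannian_bracket_row_span:
  fixes X :: "real^'n::{finite,linorder}^'k::{finite,linorder}"
  assumes P: "grassmannian_bracket \<alpha> \<beta> TYPE('k) P"
    and f: "smooth_fun (grassmannian :: (real^'n::{finite,linorder}^'k::{finite,linorder}, _) space) f"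
    and g: "smooth_fun (grassmannian :: (real^'n::{finite,linorder}^'k::{finite,linorder}, _) space) g"
    and X: "X \<in> full_rank"
  shows "P f g (row_span X) =
    mat_bracket ((\<beta> - \<alpha>) / 2) ((\<alpha> + \<beta>) / 2) (\<lambda>X. f (row_span X)) (\<lambda>X. g (row_span X)) X"
proof -
  obtain \<iota> :: "'k \<Rightarrow> 'n" where \<iota>: "strict_mono \<iota>" "invertible (minor_matrix \<iota> X)"
    using X by (rule full_rank_imp_invertible_minor)
  have inj: "inj \<iota>" using \<iota>(1) by (rule strict_mono_imp_inj_on)
  let ?M = "matrix_inv (minor_matrix \<iota> X) ** X"
  have X': "row_span X = cell_param \<iota> ?M"
    by (rule row_span_eq_cell_param[OF inj \<iota>(2)])
  have "P f g (row_span X) = entries_bracket (- range \<iota>) (cell_coeff \<alpha> \<beta> \<iota>) (f \<circ> cell_param \<iota>) (g \<circ> cell_param \<iota>) ?M"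
    unfolding X' using P f g \<iota>(1) by (simp add: grassmannian_bracket_def)
  also have "\<dots> = mat_bracket ((\<beta> - \<alpha>) / 2) ((\<alpha> + \<beta>) / 2) (\<lambda>X. f (row_span X)) (\<lambda>X. g (row_span X)) (cell_matrix \<iota> ?M)"
    by (rule mat_bracket_cell_param[OF \<iota>(1) f g, symmetric])
  also have "\<dots> = mat_bracket ((\<beta> - \<alpha>) / 2) ((\<alpha> + \<beta>) / 2) (\<lambda>X. f (row_span X)) (\<lambda>X. g (row_span X)) X"
    using X' by (intro mat_bracket_row_span_cong[OF f g X cell_matrix_full_rank[OF inj]]) (simp add: cell_param_eq)
  finally show ?thesis .
qed

section \<open>The action\<close>

lemma smooth_map_grassmannian_act:
  "smooth_map (prod_space (grassmannian :: (real^'n::{finite,linorder}^'k::{finite,linorder}, _) space) GL_space)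
    (grassmannian :: (real^'n::{finite,linorder}^'k::{finite,linorder}, _) space) (\<lambda>(V, A). grassmannian_act V A)"
  unfolding smooth_map_def
proof (intro conjI allI impI)
  let ?Gr = "grassmannian :: (real^'n::{finite,linorder}^'k::{finite,linorder}, _) space"
  show "(\<lambda>(V, A). grassmannian_act V A) ` pts (prod_space ?Gr GL_space) \<subseteq> pts ?Gr"
  proof clarify
    fix V and A :: "real^'n::{finite,linorder}^'n::{finite,linorder}" assume "(V, A) \<in> pts (prod_space ?Gr GL_space)"
    then have V: "V \<in> pts ?Gr" and A: "invertible A" by (auto simp: prod_space_def GL_space_def)
    from V obtain X :: "real^'n::{finite,linorder}^'k::{finite,linorder}" where "X \<in> full_rank" "V = row_span X"
      by (rule grassmannian_cases)
    then show "grassmannian_act V A \<in> pts ?Gr"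
      by (simp add: grassmannian_act_row_span row_span_in_grassmannian full_rank_matrix_mult[OF _ A])
  qed
  fix f assume f: "smooth_fun ?Gr f"
  let ?S = "(UNIV :: (real^'n::{finite,linorder}^'k::{finite,linorder}) set) \<times>
    {A :: real^'n::{finite,linorder}^'n::{finite,linorder}. invertible A}"
  have S: "open ?S" by (intro open_Times open_invertible open_UNIV)
  have "smooth_on ?S (\<lambda>x. f (row_span (cell_matrix \<iota> (fst x) ** snd x)))" if "strict_mono \<iota>" for \<iota> :: "'k \<Rightarrow> 'n"
  proof (rule smooth_on_compose_matrix[OF S open_full_rank _ f[unfolded smooth_fun_grassmannian_iff]])
    show "(\<lambda>x. cell_matrix \<iota> (fst x) ** snd x) ` ?S \<subseteq> full_rank"
      using cell_matrix_full_rank[OF strict_mono_imp_inj_on[OF that]] by (auto intro: full_rank_matrix_mult)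
    have "smooth_on ?S (\<lambda>x. cell_matrix \<iota> (fst x) $ p $ j)" for p j
      using S by (cases "j \<in> range \<iota>") (simp_all add: cell_matrix_def smooth_on_const smooth_on_fst_entry)
    then show "smooth_on ?S (\<lambda>x. (cell_matrix \<iota> (fst x) ** snd x) $ p $ j)" for p j
      by (intro smooth_on_matrix_mult S smooth_on_snd_entry)
  qed
  then show "smooth_fun (prod_space ?Gr GL_space) (f \<circ> (\<lambda>(V, A). grassmannian_act V A))"
    by (auto simp: smooth_fun_def prod_space_def grassmannian_def GL_space_def o_def case_prod_beta map_prod_def
        cell_param_eq grassmannian_act_row_span)
qed

text \<open>With a representative \<open>X\<close> of \<open>V\<close>, each bracket becomes a
  quadratic matrix bracket, and the claim is multiplicativity at \<open>X ** A\<close>.\<close>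

lemma poisson_map_grassmannian_act:
  assumes P: "grassmannian_bracket \<alpha> \<beta> TYPE('k::{finite,linorder}) (P :: (real^'n::{finite,linorder}) set bracket)"
  shows "poisson_map (prod_space (grassmannian :: (real^'n::{finite,linorder}^'k::{finite,linorder}, _) space) GL_space)
    (prod_bracket P (GL_bracket \<beta> \<alpha>)) (grassmannian :: (real^'n::{finite,linorder}^'k::{finite,linorder}, _) space) P
    (\<lambda>(V, A). grassmannian_act V A)"
  unfolding poisson_map_def
proof (intro conjI allI impI ballI smooth_map_grassmannian_act)
  let ?Gr = "grassmannian :: (real^'n::{finite,linorder}^'k::{finite,linorder}, _) space"
  fix f g and x :: "(real^'n::{finite,linorder}) set \<times> (real^'n::{finite,linorder}^'n::{finite,linorder})"
  assume f: "smooth_fun ?Gr f" and g: "smooth_fun ?Gr g" and x: "x \<in> pts (prod_space ?Gr GL_space)"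
  obtain V A where VA: "x = (V, A)" by fastforce
  have V: "V \<in> pts ?Gr" and A: "invertible A" using x by (auto simp: VA prod_space_def GL_space_def)
  obtain X :: "real^'n::{finite,linorder}^'k::{finite,linorder}" where X: "X \<in> full_rank" and VX: "V = row_span X"
    using V by (rule grassmannian_cases)
  have XA: "X ** A \<in> full_rank" by (rule full_rank_matrix_mult[OF X A])
  have act: "smooth_fun ?Gr (\<lambda>u. h (grassmannian_act u A))" if "smooth_fun ?Gr h" for h
    unfolding smooth_fun_grassmannian_iff grassmannian_act_row_span
    by (rule smooth_on_compose_matrix[OF open_full_rank open_full_rank _ that[unfolded smooth_fun_grassmannian_iff]])
      (auto intro: full_rank_matrix_mult[OF _ A] smooth_on_matrix_mult_left open_full_rank)
  have diff: "(\<lambda>X. h (row_span X)) differentiable (at (X ** A))" if "smooth_fun ?Gr h" for h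
    by (rule smooth_on_imp_differentiable[OF that[unfolded smooth_fun_grassmannian_iff] XA])
  have "P f g (grassmannian_act V A) =
      mat_bracket ((\<beta> - \<alpha>) / 2) ((\<alpha> + \<beta>) / 2) (\<lambda>X. f (row_span X)) (\<lambda>X. g (row_span X)) (X ** A)"
    unfolding VX grassmannian_act_row_span by (rule grassmannian_bracket_row_span[OF P f g XA])
  also have "\<dots> = P (\<lambda>u. f (grassmannian_act u A)) (\<lambda>u. g (grassmannian_act u A)) V +
      GL_bracket \<beta> \<alpha> (\<lambda>B. f (grassmannian_act V B)) (\<lambda>B. g (grassmannian_act V B)) A"
    unfolding VX grassmannian_bracket_row_span[OF P act[OF f] act[OF g] X] grassmannian_act_row_span GL_bracket_eq
    by (rule mat_bracket_matrix_mult[OF diff[OF f] diff[OF g]])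
  finally show "prod_bracket P (GL_bracket \<beta> \<alpha>) (f \<circ> (\<lambda>(V, A). grassmannian_act V A))
      (g \<circ> (\<lambda>(V, A). grassmannian_act V A)) x = P f g ((\<lambda>(V, A). grassmannian_act V A) x)"
    by (simp add: VA prod_bracket_def)
qed

section \<open>Homogeneity\<close>

lemma grassmannian_act_mult: "grassmannian_act (grassmannian_act V A) B = grassmannian_act V (A ** B)"
  by (simp add: grassmannian_act_def image_image vector_matrix_mul_assoc)

lemma grassmannian_act_one: "grassmannian_act V (mat 1) = V"
  by (simp add: grassmannian_act_def)

text \<open>Bases of \<open>V\<close> and \<open>W\<close> are extended to bases of the whole space;
  a bijection that matches the parts inside \<open>V\<close> and \<open>W\<close> extends to an
  invertible linear map.\<close>

lemma grassmannian_act_transitive: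
  fixes V W :: "(real^'n) set"
  assumes "subspace V" "subspace W" "dim V = dim W"
  obtains A where "invertible A" "grassmannian_act V A = W"
proof -
  obtain B where B: "B \<subseteq> V" "independent B" "V \<subseteq> span B" "card B = dim V"
    using basis_exists by blast
  obtain C where C: "C \<subseteq> W" "independent C" "W \<subseteq> span C" "card C = dim W"
    using basis_exists by blast
  obtain B' where B': "B \<subseteq> B'" "B' \<subseteq> UNIV" "independent B'" "UNIV \<subseteq> span B'"
    by (rule maximal_independent_subset_extend[OF subset_UNIV B(2)])
  obtain C' where C': "C \<subseteq> C'" "C' \<subseteq> UNIV" "independent C'" "UNIV \<subseteq> span C'"
    by (rule maximal_independent_subset_extend[OF subset_UNIV C(2)])
  have fin: "finite B'" "finite C'"
    using B'(3) C'(3) independent_imp_finite by blast+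
  then have fin': "finite B" "finite C"
    using B'(1) C'(1) finite_subset by blast+
  have span: "span B' = UNIV" "span C' = UNIV"
    using B'(4) C'(4) by auto
  have "card B' = card C'"
    using dim_span_eq_card_independent[OF B'(3)] dim_span_eq_card_independent[OF C'(3)] by (simp add: span)
  then have "card (B' - B) = card (C' - C)"
    using B'(1) C'(1) fin' B(4) C(4) assms(3) by (simp add: card_Diff_subset)
  then obtain h2 where h2: "bij_betw h2 (B' - B) (C' - C)"
    using fin by (metis bij_betw_iff_card finite_Diff)
  obtain h1 where h1: "bij_betw h1 B C"
    using fin' B(4) C(4) assms(3) by (metis bij_betw_iff_card)
  define h where "h x = (if x \<in> B then h1 x else h2 x)" for x
  have hB: "h ` B = C"
    using h1 by (auto simp: h_def bij_betw_def)
  have "h ` (B' - B) = C' - C"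
    using h2 by (auto simp: h_def bij_betw_def)
  then have hB': "h ` B' = C'"
    using hB B'(1) C'(1) by blast
  obtain g where g: "linear g" "\<And>x. x \<in> B' \<Longrightarrow> g x = h x"
    using linear_independent_extend[OF B'(3), of h] by blast
  have "g ` V = W"
  proof -
    have "V = span B" "W = span C"
      using B(1,3) C(1,3) assms(1,2) by (simp_all add: span_minimal subset_antisym)
    then show ?thesis
      using g(2) B'(1) hB by (simp add: linear_span_image[OF g(1), symmetric]) (metis image_cong subsetD)
  qed
  have "g ` UNIV = UNIV"
  proof -
    have "g ` span B' = span (h ` B')"
      using g(2) by (simp add: linear_span_image[OF g(1), symmetric] cong: image_cong)
    then show ?thesis
      by (simp add: hB' span)
  qed
  \<comment> \<open>The transpose appears because row vectors are multiplied from the right.\<close>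
  define A where "A = transpose (matrix g)"
  have gA: "x v* A = g x" for x
    by (simp add: A_def matrix_works g(1) flip: transpose_matrix_vector)
  have "surj ((*v) (matrix g))"
    using \<open>g ` UNIV = UNIV\<close> by (simp add: matrix_works g(1))
  then have "invertible (matrix g)"
    using matrix_left_right_inverse matrix_right_invertible_surjective unfolding invertible_def by metis
  then have "invertible A"
    by (simp add: A_def invertible_det_nz det_transpose)
  moreover have "grassmannian_act V A = W"
    using \<open>g ` V = W\<close> by (simp add: grassmannian_act_def gA)
  ultimately show thesis by (rule that)
qed

text \<open>The smooth structure is the quotient one. The orbit map is smooth; conversely, a smooth
  local section through a given point recovers \<open>f\<close> from its pullback to the
  group.\<close>

lemma smooth_fun_grassmannian_iff_orbit_map:
  fixes V :: "(real^'n::{finite,linorder}) set"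
  assumes V: "V \<in> pts (grassmannian :: (real^'n::{finite,linorder}^'k::{finite,linorder}, _) space)"
  shows "smooth_fun (grassmannian :: (real^'n::{finite,linorder}^'k::{finite,linorder}, _) space) f \<longleftrightarrow>
    smooth_fun GL_space (\<lambda>A. f (grassmannian_act V A))"
proof -
  obtain X0 :: "real^'n::{finite,linorder}^'k::{finite,linorder}" where X0: "X0 \<in> full_rank" "V = row_span X0"
    using V by (rule grassmannian_cases)
  show ?thesis
    unfolding smooth_fun_grassmannian_iff smooth_fun_GL_iff
  proof
    assume "smooth_on (full_rank :: (real^'n::{finite,linorder}^'k::{finite,linorder}) set) (\<lambda>X. f (row_span X))"
    then have "smooth_on {A. invertible A} (\<lambda>A. f (row_span (X0 ** A)))"
      by (rule smooth_on_compose_matrix[OF open_invertible open_full_rank, rotated])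
        (auto intro: full_rank_matrix_mult[OF X0(1)] smooth_on_matrix_mult_right open_invertible)
    then show "smooth_on {A. invertible A} (\<lambda>A. f (grassmannian_act V A))"
      by (simp add: X0(2) grassmannian_act_row_span)
  next
    assume f: "smooth_on {A. invertible A} (\<lambda>A. f (grassmannian_act V A))"
    show "smooth_on (full_rank :: (real^'n::{finite,linorder}^'k::{finite,linorder}) set) (\<lambda>X. f (row_span X))"
    proof (rule smooth_on_local[OF open_full_rank])
      fix X :: "real^'n::{finite,linorder}^'k::{finite,linorder}" assume X: "X \<in> full_rank"
      then have "dim V = dim (row_span X)"
        using X0 by (simp add: full_rank_iff_dim)
      then obtain A where A: "invertible A" "grassmannian_act V A = row_span X"
        using subspace_row_span X0(2) by (metis grassmannian_act_transitive)
      obtain Y where Y: "X ** Y = mat 1" using X by (auto simp: full_rank_def)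
      \<comment> \<open>a local section of the orbit map of \<open>X\<close>: \<open>X ** s Z = Z\<close>\<close>
      define s where "s Z = mat 1 + Y ** (Z - X)" for Z
      have s: "X ** s Z = Z" for Z
        by (simp add: s_def matrix_add_ldistrib matrix_mul_assoc Y)
      have As: "smooth_on S (\<lambda>Z. (A ** s Z) $ i $ j)" if "open S" for S i j
      proof -
        have "smooth_on S (\<lambda>Z. Z $ p $ q + - X $ p $ q)" for p q
          by (intro smooth_on_add smooth_on_entry smooth_on_const that)
        then have "smooth_on S (\<lambda>Z. (Y ** (Z - X)) $ p $ q)" for p q
          by (intro smooth_on_matrix_mult smooth_on_const that) simp
        then have "smooth_on S (\<lambda>Z. s Z $ p $ q)" for p q
          unfolding s_def by (simp add: smooth_on_add smooth_on_const that)
        then show ?thesis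
          by (intro smooth_on_matrix_mult smooth_on_const that)
      qed
      \<comment> \<open>\<open>A\<close> moves the base point \<open>V\<close> to the row span of
        \<open>X\<close>, and \<open>s Z\<close> moves it on to that of \<open>Z\<close>; since
        \<open>s X\<close> is the identity, \<open>X\<close> lies in \<open>?T\<close>.\<close>
      let ?T = "{Z. invertible (A ** s Z)}"
      have T: "open ?T" by (rule open_preimage_invertible) (rule As, simp)
      have "X \<in> ?T" by (simp add: s_def A)
      have sm: "smooth_on ?T (\<lambda>Z. f (grassmannian_act V (A ** s Z)))"
        by (rule smooth_on_compose_matrix[OF T open_invertible _ f As[OF T]]) auto
      have "grassmannian_act V (A ** s Z) = row_span Z" for Z
        by (simp add: A(2) grassmannian_act_row_span s flip: grassmannian_act_mult)
      then have "smooth_on ?T (\<lambda>Z. f (row_span Z))"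
        using sm by simp
      then show "\<exists>T. open T \<and> X \<in> T \<and> smooth_on T (\<lambda>Z. f (row_span Z))"
        using T \<open>X \<in> ?T\<close> by blast
    qed
  qed
qed

lemma homogeneous_space_grassmannian:
  assumes "CARD('k::{finite,linorder}) \<le> CARD('n::{finite,linorder})"
  shows "homogeneous_space GL_space GL_group
    (grassmannian :: (real^'n::{finite,linorder}^'k::{finite,linorder}, _) space) grassmannian_act"
proof -
  let ?Gr = "grassmannian :: (real^'n::{finite,linorder}^'k::{finite,linorder}, _) space"
  let ?G = "GL_group :: (real^'n::{finite,linorder}^'n::{finite,linorder}) monoid"
  interpret group ?G by (rule group_GL)
  note act = grassmannian_act_mult grassmannian_act_one
  obtain V :: "(real^'n::{finite,linorder}) set" where V: "subspace V" "dim V = CARD('k)"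
    using choose_subspace_of_subspace[of "CARD('k)" "UNIV :: (real^'n::{finite,linorder}) set"] assms by auto
  then have VGr: "V \<in> pts ?Gr" by (simp add: pts_grassmannian)
  obtain X :: "real^'n::{finite,linorder}^'k::{finite,linorder}" where X: "X \<in> full_rank" "V = row_span X"
    using VGr by (rule grassmannian_cases)
  \<comment> \<open>The stabilizer of the base point.\<close>
  define H where "H = {A. invertible A \<and> grassmannian_act V A = V}"
  have H: "subgroup H ?G"
  proof (rule subgroupI)
    show "H \<noteq> {}" using one_closed by (auto simp: H_def GL_group_def act intro!: exI[of _ "mat 1"])
    fix A assume A: "A \<in> H"
    then have "grassmannian_act V (matrix_inv A) = grassmannian_act (grassmannian_act V A) (matrix_inv A)"
      by (simp add: H_def)
    then show "inv\<^bsub>?G\<^esub> A \<in> H"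
      using A by (simp add: H_def GL_inv act matrix_inv_cancel invertible_matrix_inv)
    fix B assume "B \<in> H"
    then show "A \<otimes>\<^bsub>?G\<^esub> B \<in> H"
      using A by (simp add: H_def GL_mult invertible_mult flip: act(1))
  qed (auto simp: H_def carrier_GL)
  have closed: "closedin (top_of_set (carrier ?G)) H"
  proof -
    \<comment> \<open>Linear, hence closed, conditions on \<open>A\<close>: they say that
      \<open>A\<close> maps the spanning rows of \<open>X\<close> into \<open>V\<close>. Inclusion
      suffices because an invertible \<open>A\<close> preserves the dimension.\<close>
    let ?C = "\<Inter>p. {A. (X ** A) $ p \<in> V}"
    have "closed {A. (X ** A) $ p \<in> V}" for p
      using closed_vimage[OF closed_subspace[OF V(1)] linear_continuous_on[OF
          bounded_linear_compose[OF bounded_linear_vec_nth bounded_linear_matrix_mult_right]]]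
      by (simp add: vimage_def)
    then have "closed ?C" by blast
    moreover have "H = carrier ?G \<inter> ?C"
    proof -
      have fix_iff: "grassmannian_act V A = V \<longleftrightarrow> (\<forall>p. (X ** A) $ p \<in> V)" if A: "invertible A" for A
      proof -
        have "dim (row_span (X ** A)) = dim V"
          using full_rank_matrix_mult[OF X(1) A] V(2) by (simp add: full_rank_iff_dim)
        then have "row_span (X ** A) = V \<longleftrightarrow> row_span (X ** A) \<subseteq> V"
          using subspace_dim_equal[OF subspace_row_span V(1), of "X ** A"] by auto
        also have "\<dots> \<longleftrightarrow> rows (X ** A) \<subseteq> V"
          unfolding row_span_def using V(1) span_minimal span_superset by blast
        also have "\<dots> \<longleftrightarrow> (\<forall>p. (X ** A) $ p \<in> V)"
          by (auto simp: rows_def row_def vec_lambda_eta)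
        finally show ?thesis by (simp add: X(2) grassmannian_act_row_span)
      qed
      have "A \<in> H \<longleftrightarrow> A \<in> carrier ?G \<inter> ?C" for A
        using fix_iff[of A] by (cases "invertible A") (simp_all add: H_def carrier_GL)
      then show ?thesis by blast
    qed
    ultimately show ?thesis unfolding closedin_closed by blast
  qed
  have cosets: "grassmannian_act V g = grassmannian_act V h \<longleftrightarrow> H #>\<^bsub>?G\<^esub> g = H #>\<^bsub>?G\<^esub> h"
    if g: "g \<in> carrier ?G" and h: "h \<in> carrier ?G" for g h
  proof
    assume eq: "grassmannian_act V g = grassmannian_act V h"
    \<comment> \<open>For right cosets, equal images of \<open>V\<close> mean that
      \<open>h ** matrix_inv g\<close> stabilizes \<open>V\<close>.\<close>
    have "grassmannian_act V (h ** matrix_inv g) = grassmannian_act (grassmannian_act V g) (matrix_inv g)"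
      by (simp add: eq act)
    then have "h ** matrix_inv g \<in> H"
      using g h by (simp add: H_def carrier_GL act matrix_inv_cancel invertible_mult invertible_matrix_inv)
    moreover have "h = (h ** matrix_inv g) \<otimes>\<^bsub>?G\<^esub> g"
      using g by (simp add: carrier_GL GL_mult matrix_inv_cancel flip: matrix_mul_assoc)
    ultimately have "h \<in> H #>\<^bsub>?G\<^esub> g" unfolding r_coset_def by blast
    then show "H #>\<^bsub>?G\<^esub> g = H #>\<^bsub>?G\<^esub> h" using repr_independence[OF _ g H] by blast
  next
    assume "H #>\<^bsub>?G\<^esub> g = H #>\<^bsub>?G\<^esub> h"
    then have "h \<in> H #>\<^bsub>?G\<^esub> g" using rcos_self[OF h H] by simp
    then obtain k where "k \<in> H" "h = k ** g" by (auto simp: r_coset_def GL_mult)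
    then show "grassmannian_act V g = grassmannian_act V h"
      by (simp add: H_def flip: act(1))
  qed
  have orbit: "grassmannian_act V ` carrier ?G = pts ?Gr"
  proof
    show "grassmannian_act V ` carrier ?G \<subseteq> pts ?Gr"
      by (auto simp: X(2) grassmannian_act_row_span carrier_GL
          intro!: row_span_in_grassmannian[OF full_rank_matrix_mult[OF X(1)]])
    show "pts ?Gr \<subseteq> grassmannian_act V ` carrier ?G"
    proof
      fix W assume "W \<in> pts ?Gr"
      then obtain A where "invertible A" "grassmannian_act V A = W"
        using V by (metis grassmannian_act_transitive pts_grassmannian)
      then show "W \<in> grassmannian_act V ` carrier ?G" by (auto simp: carrier_GL)
    qed
  qed
  show ?thesis
    unfolding homogeneous_space_def
  proof (intro conjI ballI)
    show "grassmannian_act W \<one>\<^bsub>?G\<^esub> = W" for W :: "(real^'n::{finite,linorder}) set"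
      by (simp add: GL_group_def act)
    show "grassmannian_act W (g \<otimes>\<^bsub>?G\<^esub> h) = grassmannian_act (grassmannian_act W g) h"
      for W :: "(real^'n::{finite,linorder}) set" and g h
      by (simp add: GL_mult act)
    show "\<exists>x0\<in>pts ?Gr. \<exists>H. subgroup H ?G \<and> closedin (top_of_set (carrier ?G)) H \<and>
        (\<forall>g\<in>carrier ?G. \<forall>h\<in>carrier ?G. grassmannian_act x0 g = grassmannian_act x0 h \<longleftrightarrow> H #>\<^bsub>?G\<^esub> g = H #>\<^bsub>?G\<^esub> h) \<and>
        grassmannian_act x0 ` carrier ?G = pts ?Gr \<and>
        (\<forall>f. smooth_fun ?Gr f \<longleftrightarrow> smooth_fun GL_space (\<lambda>g. f (grassmannian_act x0 g)))"
      using VGr H closed cosets orbit smooth_fun_grassmannian_iff_orbit_map[OF VGr] by blast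
  qed
qed

text \<open>The existence clause ensures that the universal one is not vacuous; the bound on
  \<open>k\<close> provides a base point.\<close>

theorem theorem4p8:
  fixes \<alpha> \<beta> :: real
  assumes "CARD('k::{finite,linorder}) \<le> CARD('n::{finite,linorder})"
  shows "(\<exists>P. grassmannian_bracket \<alpha> \<beta> TYPE('k) (P :: (real^'n::{finite,linorder}) set bracket)) \<and>
    (\<forall>P :: (real^'n::{finite,linorder}) set bracket. grassmannian_bracket \<alpha> \<beta> TYPE('k) P \<longrightarrow>
       poisson_homogeneous_space GL_space GL_group (GL_bracket \<beta> \<alpha>)
         (grassmannian :: (real^'n::{finite,linorder}^'k::{finite,linorder}, (real^'n::{finite,linorder}) set) space) grassmannian_act P)"
proof (intro conjI allI impI)
  show "\<exists>P. grassmannian_bracket \<alpha> \<beta> TYPE('k) (P :: (real^'n::{finite,linorder}) set bracket)"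
    using grassmannian_bracket_descended by blast
  fix P :: "(real^'n::{finite,linorder}) set bracket"
  assume P: "grassmannian_bracket \<alpha> \<beta> TYPE('k) P"
  show "poisson_homogeneous_space GL_space GL_group (GL_bracket \<beta> \<alpha>)
      (grassmannian :: (real^'n::{finite,linorder}^'k::{finite,linorder}, (real^'n::{finite,linorder}) set) space) grassmannian_act P"
    unfolding poisson_homogeneous_space_def
  proof (intro conjI homogeneous_space_grassmannian[OF assms] poisson_map_grassmannian_act[OF P])
    show "poisson_lie_group GL_space GL_group (GL_bracket \<beta> \<alpha> :: (real^'n::{finite,linorder}^'n::{finite,linorder}) bracket)"
      unfolding GL_bracket_eq by (rule poisson_lie_group_GL)
    show "poisson_bracket (grassmannian :: (real^'n::{finite,linorder}^'k::{finite,linorder}, _) space) P"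
      using P by (simp add: grassmannian_bracket_def)
  qed
qed

end
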